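(* Let $\rho\in\mathbb{N}$ (so $\rho\ge1$) and $p>0$. There is a subset of the Fréchet space $E_{\rho,p}$, which is $G_\delta$ and dense in $E_{\rho,p}$, such that for every $f$ in this subset the solution $w=w(z)$ of the equation $f(w)=z$ cannot be represented via $z$ and complex constants by a finite number of the following actions: algebraic operations (rational operations and solutions of polynomial equations) and quadratures (in particular, superpositions with elementary functions).
   Context: $E_{\rho,p}$ is the complex vector space of entire functions $f:\mathbb{C}\to\mathbb{C}$ with $\lim_{R\to\infty}\sup_{|z|\ge R}\frac{\ln|f(z)|}{|z|^\rho}\le p$, with the Fréchet topology generated by the norms $\|f\|_n=\sup_{z\in\mathbb{C}}\exp[-(p+1/n)|z|^\rho]\,|f(z)|$, $n\in\mathbb{N}$. A $G_\delta$ set is a countable intersection of open sets. Representability is understood as follows: a holomorphic germ $\varphi$ at a point $z_0\in\mathbb{C}$ is representable if there is a finite sequence of holomorphic germs $\varphi_1,\dots,\varphi_n=\varphi$ at $z_0$ such that each $\varphi_i$ is one of: a complex constant; the germ of $z$; a sum, difference, product or quotient (where defined) of earlier germs; a solution of a polynomial equation, with not identically zero polynomial, whose coefficients are earlier germs; an antiderivative of an earlier germ; or a composition $e\circ\varphi_j$ of an earlier germ with a holomorphic germ at $\varphi_j(z_0)$ of a basic elementary function (exponential, logarithm, power, trigonometric or inverse trigonometric function). The solution of $f(w)=z$ is not representable if no holomorphic germ $w(z)$ at any point $z_0$ with $f(w(z))=z$ near $z_0$ is representable. *)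

theory Defs
  imports "HOL-Complex_Analysis.Complex_Analysis"
begin

section \<open>The spaces of entire functions\<close>

text \<open>\<^term>\<open>\<lambda>z. ln (cmod (f z)) / cmod z ^ \<rho>\<close> as an extended real, with \<open>ln 0 = -\<infinity>\<close>
  (the library's real logarithm has \<open>ln 0 = 0\<close>). The value at \<open>z = 0\<close> plays no role in the limit below.\<close>

definition log_growth :: "nat \<Rightarrow> (complex \<Rightarrow> complex) \<Rightarrow> complex \<Rightarrow> ereal" where
  "log_growth \<rho> f z =
     (if f z = 0 then -\<infinity> else ereal (ln (cmod (f z)) / cmod z ^ \<rho>))"

definition E_space :: "nat \<Rightarrow> real \<Rightarrow> (complex \<Rightarrow> complex) set" where
  "E_space \<rho> p = {f. f holomorphic_on UNIV \<and>
     (\<exists>L. ((\<lambda>R::real. SUP z\<in>{z. R \<le> cmod z}. log_growth \<rho> f z) \<longlongrightarrow> L) at_top \<and> L \<le> ereal p)}"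

text \<open>The index \<open>n\<close> ranges over the positive integers. On \<^term>\<open>E_space \<rho> p\<close> the supremum is over
  a set that is bounded above, see \<open>bdd_above_E_norm\<close> below.\<close>

definition E_norm :: "nat \<Rightarrow> real \<Rightarrow> nat \<Rightarrow> (complex \<Rightarrow> complex) \<Rightarrow> real" where
  "E_norm \<rho> p n f = (SUP z. exp (- (p + 1 / real n) * cmod z ^ \<rho>) * cmod (f z))"

definition E_topology :: "nat \<Rightarrow> real \<Rightarrow> (complex \<Rightarrow> complex) topology" where
  "E_topology \<rho> p = topology_generated_by
     {{f \<in> E_space \<rho> p. E_norm \<rho> p n (\<lambda>z. f z - g z) < \<epsilon>} | g n \<epsilon>.
        g \<in> E_space \<rho> p \<and> n \<ge> 1 \<and> \<epsilon> > 0}"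

lemma topspace_E_topology: "topspace (E_topology \<rho> p) = E_space \<rho> p"
proof -
  have "f \<in> {h \<in> E_space \<rho> p. E_norm \<rho> p 1 (\<lambda>z. h z - f z) < 1}" if "f \<in> E_space \<rho> p" for f
    using that by (simp add: E_norm_def)
  then show ?thesis
    unfolding E_topology_def topology_generated_by_topspace
    by (intro equalityI subsetI) (blast, use zero_less_one in blast)
qed

lemma bdd_above_E_norm:
  assumes f: "f \<in> E_space \<rho> p" and n: "n \<ge> 1"
  shows "bdd_above (range (\<lambda>z. exp (- (p + 1 / real n) * cmod z ^ \<rho>) * cmod (f z)))"
proof -
  define q where "q = p + 1 / real n"
  have "p < q" using n by (simp add: q_def)
  obtain L where L: "((\<lambda>R::real. SUP z\<in>{z. R \<le> cmod z}. log_growth \<rho> f z) \<longlongrightarrow> L) at_top"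
    "L \<le> ereal p" and hol: "f holomorphic_on UNIV"
    using f by (auto simp: E_space_def)
  have "L < ereal q"
    using L(2) \<open>p < q\<close> by (meson ereal_less(2) le_less_trans less_ereal.simps(1))
  with L(1) have "\<forall>\<^sub>F R in at_top. (SUP z\<in>{z. R \<le> cmod z}. log_growth \<rho> f z) < ereal q"
    by (rule order_tendstoD)
  then obtain R0 where R0: "\<And>R. R \<ge> R0 \<Longrightarrow> (SUP z\<in>{z. R \<le> cmod z}. log_growth \<rho> f z) < ereal q"
    by (auto simp: eventually_at_top_linorder)
  define R where "R = max R0 1"
  have out: "exp (- q * cmod z ^ \<rho>) * cmod (f z) \<le> 1" if z: "R \<le> cmod z" for z
  proof (cases "f z = 0")
    case False
    have pos: "cmod z ^ \<rho> > 0" using z by (intro zero_less_power) (auto simp: R_def)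
    have "log_growth \<rho> f z \<le> (SUP z\<in>{z. R \<le> cmod z}. log_growth \<rho> f z)"
      using z by (intro SUP_upper) auto
    also have "\<dots> < ereal q" by (rule R0) (simp add: R_def)
    finally have "ln (cmod (f z)) / cmod z ^ \<rho> < q"
      using False by (simp add: log_growth_def)
    then have "ln (cmod (f z)) \<le> q * cmod z ^ \<rho>"
      using pos by (simp add: field_simps)
    then have "cmod (f z) \<le> exp (q * cmod z ^ \<rho>)"
      using False by (metis exp_le_cancel_iff exp_ln zero_less_norm_iff)
    then show ?thesis by (simp add: exp_minus field_simps)
  qed simp
  have "continuous_on (cball 0 R) (\<lambda>z. exp (- q * cmod z ^ \<rho>) * cmod (f z))"
    by (intro continuous_intros holomorphic_on_imp_continuous_on
        holomorphic_on_subset[OF hol]) auto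
  then have "bounded ((\<lambda>z. exp (- q * cmod z ^ \<rho>) * cmod (f z)) ` cball 0 R)"
    by (intro compact_imp_bounded compact_continuous_image) auto
  then obtain B where B: "\<And>z. cmod z \<le> R \<Longrightarrow> exp (- q * cmod z ^ \<rho>) * cmod (f z) \<le> B"
    by (fastforce simp: bounded_iff)
  show ?thesis
    unfolding q_def[symmetric]
  proof (rule bdd_aboveI2)
    fix z show "exp (- q * cmod z ^ \<rho>) * cmod (f z) \<le> max B 1"
      using B[of z] out[of z] by (cases "cmod z \<le> R") auto
  qed
qed

section \<open>Representable germs\<close>

text \<open>A holomorphic germ at \<open>c\<close> is given by a function analytic at \<open>c\<close>; two such functions are
  the same germ if they agree on a neighbourhood of \<open>c\<close> (including \<open>c\<close> itself).\<close>

definition germ_eq :: "complex \<Rightarrow> (complex \<Rightarrow> complex) \<Rightarrow> (complex \<Rightarrow> complex) \<Rightarrow> bool" where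
  "germ_eq c f g \<longleftrightarrow> (\<forall>\<^sub>F z in nhds c. f z = g z)"

definition log_germ :: "complex \<Rightarrow> (complex \<Rightarrow> complex) \<Rightarrow> bool" where
  "log_germ c l \<longleftrightarrow> l analytic_on {c} \<and> germ_eq c (\<lambda>w. exp (l w)) (\<lambda>w. w)"

definition trig_functions :: "(complex \<Rightarrow> complex) set" where
  "trig_functions = {sin, cos, tan, cot, \<lambda>w. 1 / cos w, \<lambda>w. 1 / sin w}"

text \<open>Multivalued functions contribute all of their holomorphic branches. Because of the analyticity
  requirement, the conventional values of \<^const>\<open>tan\<close>, \<^const>\<open>cot\<close>, \dots at their poles do not
  give rise to germs. A power \<open>w\<^sup>a\<close> with arbitrary complex exponent is \<open>exp (a * log w)\<close>
  at \<open>c \<noteq> 0\<close>; at \<open>c = 0\<close> it is holomorphic only for natural exponents.\<close>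

definition basic_elementary_germ :: "complex \<Rightarrow> (complex \<Rightarrow> complex) \<Rightarrow> bool" where
  "basic_elementary_germ c e \<longleftrightarrow> e analytic_on {c} \<and>
     (germ_eq c e exp \<or>
      log_germ c e \<or>
      (\<exists>k::nat. germ_eq c e (\<lambda>w. w ^ k)) \<or>
      (\<exists>a l. log_germ c l \<and> germ_eq c e (\<lambda>w. exp (a * l w))) \<or>
      (\<exists>T\<in>trig_functions. germ_eq c e T) \<or>
      (\<exists>T\<in>trig_functions. germ_eq c (\<lambda>w. T (e w)) (\<lambda>w. w)))"

text \<open>\<open>admissible_step c G \<phi>\<close>: the germ \<open>\<phi>\<close> at \<open>c\<close> arises from the germs in \<open>G\<close> by one action.
  A quotient is defined if the denominator is not the zero germ and the quotient, which is
  a priori meromorphic, is holomorphic; hence the punctured neighbourhood filter \<^term>\<open>at c\<close>.\<close>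

definition admissible_step ::
    "complex \<Rightarrow> (complex \<Rightarrow> complex) set \<Rightarrow> (complex \<Rightarrow> complex) \<Rightarrow> bool" where
  "admissible_step c G \<phi> \<longleftrightarrow> \<phi> analytic_on {c} \<and>
     ((\<exists>a. germ_eq c \<phi> (\<lambda>z. a)) \<or>
      germ_eq c \<phi> (\<lambda>z. z) \<or>
      (\<exists>g\<in>G. \<exists>h\<in>G. germ_eq c \<phi> (\<lambda>z. g z + h z)) \<or>
      (\<exists>g\<in>G. \<exists>h\<in>G. germ_eq c \<phi> (\<lambda>z. g z - h z)) \<or>
      (\<exists>g\<in>G. \<exists>h\<in>G. germ_eq c \<phi> (\<lambda>z. g z * h z)) \<or>
      (\<exists>g\<in>G. \<exists>h\<in>G. \<not> germ_eq c h (\<lambda>z. 0) \<and> (\<forall>\<^sub>F z in at c. \<phi> z = g z / h z)) \<or>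
      (\<exists>(d::nat) a. (\<forall>k\<le>d. a k \<in> G) \<and> (\<exists>k\<le>d. \<not> germ_eq c (a k) (\<lambda>z. 0)) \<and>
         germ_eq c (\<lambda>z. \<Sum>k\<le>d. a k z * \<phi> z ^ k) (\<lambda>z. 0)) \<or>
      (\<exists>g\<in>G. \<forall>\<^sub>F z in nhds c. (\<phi> has_field_derivative g z) (at z)) \<or>
      (\<exists>g\<in>G. \<exists>e. basic_elementary_germ (g c) e \<and> germ_eq c \<phi> (\<lambda>z. e (g z))))"

definition representable_germ :: "complex \<Rightarrow> (complex \<Rightarrow> complex) \<Rightarrow> bool" where
  "representable_germ c \<phi> \<longleftrightarrow>
     (\<exists>\<phi>s. \<phi>s \<noteq> [] \<and> germ_eq c (last \<phi>s) \<phi> \<and>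
        (\<forall>i<length \<phi>s. admissible_step c (set (take i \<phi>s)) (\<phi>s ! i)))"

definition inverse_not_representable :: "(complex \<Rightarrow> complex) \<Rightarrow> bool" where
  "inverse_not_representable f \<longleftrightarrow>
     (\<forall>c w. w analytic_on {c} \<and> germ_eq c (\<lambda>z. f (w z)) (\<lambda>z. z) \<longrightarrow> \<not> representable_germ c w)"

end

theory Submission
  imports Defs
begin

text \<open>Every representable germ is differentially algebraic: near some point it is one of finitely
  many holomorphic functions whose derivatives are polynomials in these functions. Inverting such a
  function, or composing with elementary functions, keeps this property, so an entire \<open>f\<close> whose
  inverse has a representable germ satisfies a nontrivial polynomial relation with constant
  coefficients between \<open>f, f', f'', \<dots>\<close>. The set of \<open>f\<close> in \<open>E\<^sub>\<rho>\<^sub>,\<^sub>p\<close> that satisfy none is \<open>G\<^sub>\<delta>\<close>, since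
  linear independence of finitely many differential monomials of \<open>f\<close> is witnessed by a nonzero
  determinant of values at finitely many points. It is dense, since for one differentially
  transcendental \<open>g\<close> and any \<open>f\<close> these determinants are nonzero at \<open>f + t g\<close> for all but countably
  many \<open>t\<close>. As \<open>g\<close> one takes a lacunary series: its partial sums would satisfy the same relation
  exactly, and linearizing the relation along \<open>g\<close> leads to a contradiction.\<close>

section \<open>Polynomial differential systems\<close>

text \<open>Finite systems, rather than single differential equations, are carried along because
  adjoining a function to a system is elementary, and because \<open>r\<close> generators limit
  everything built from them: the r + 1 functions \<open>f\<close>, \<open>f'\<close>, ...,
  \<open>f^(r)\<close> are too many to be algebraically independent. The systems live only on small
  open sets whose position is not controlled; since \<open>f\<close> is entire, the identity theorem
  spreads the final relation over the whole plane. Determinants serve two purposes: they are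
  continuous in \<open>f\<close>, which gives open sets, and along f + t g they are, up to scaling,
  holomorphic in 1/t, which gives countable exceptional sets. There are only countably many finite
  families of differential monomials, so every disc of parameters t contains one that is good for
  all families. The function \<open>g\<close> must grow more slowly than exp(q |z|) for every q > 0,
  to lie in all the spaces, while its gaps must exceed every constant ratio. Factorial exponents and
  coefficients 1/(i!)^2 achieve both.\<close>

inductive_set polys :: "(complex \<Rightarrow> complex) set \<Rightarrow> (complex \<Rightarrow> complex) set"
  for Y where
  const: "(\<lambda>z. a) \<in> polys Y"
| gen: "y \<in> Y \<Longrightarrow> y \<in> polys Y"
| add: "p \<in> polys Y \<Longrightarrow> q \<in> polys Y \<Longrightarrow> (\<lambda>z. p z + q z) \<in> polys Y"
| mult: "p \<in> polys Y \<Longrightarrow> q \<in> polys Y \<Longrightarrow> (\<lambda>z. p z * q z) \<in> polys Y"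

lemma polys_minus: "p \<in> polys Y \<Longrightarrow> (\<lambda>z. - p z) \<in> polys Y"
  using polys.mult[OF polys.const[of "-1"]] by fastforce

lemma polys_diff: "p \<in> polys Y \<Longrightarrow> q \<in> polys Y \<Longrightarrow> (\<lambda>z. p z - q z) \<in> polys Y"
  using polys.add[OF _ polys_minus] by fastforce

lemma polys_power: "p \<in> polys Y \<Longrightarrow> (\<lambda>z. p z ^ (n::nat)) \<in> polys Y"
  by (induction n) (auto intro: polys.intros)

lemma polys_sum: "(\<And>i. i \<in> I \<Longrightarrow> p i \<in> polys Y) \<Longrightarrow> (\<lambda>z. \<Sum>i\<in>I. p i z) \<in> polys Y"
  by (induction I rule: infinite_finite_induct) (auto intro: polys.intros)

lemmas polys_ops = polys.const polys.add polys.mult polys_minus polys_diff polys_power polys_sum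

lemma polys_mono: "p \<in> polys Y \<Longrightarrow> Y \<subseteq> W \<Longrightarrow> p \<in> polys W"
  by (induction rule: polys.induct) (auto intro: polys.intros)

lemma polys_insert: "p \<in> polys Y \<Longrightarrow> p \<in> polys (insert y Y)"
  by (rule polys_mono) auto

lemma polys_holomorphic:
  assumes "p \<in> polys Y" "\<And>y. y \<in> Y \<Longrightarrow> y holomorphic_on D"
  shows "p holomorphic_on D"
  using assms by (induction rule: polys.induct) (auto intro: holomorphic_intros)

text \<open>Generators and derivatives are kept in two sets because the derivative of an algebraic
  function involves the inverse of a partial derivative: there the generators are
  \<open>insert y Y\<close>, and \<open>W\<close> contains that inverse as well.\<close>

lemma polys_deriv:
  assumes "p \<in> polys Y" "open D" "Y \<subseteq> W" "\<And>y. y \<in> Y \<Longrightarrow> y holomorphic_on D"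
    "\<And>y. y \<in> Y \<Longrightarrow> \<exists>q\<in>polys W. \<forall>z\<in>D. deriv y z = q z"
  shows "\<exists>q\<in>polys W. \<forall>z\<in>D. deriv p z = q z"
  using assms(1)
proof (induction rule: polys.induct)
  case (const a)
  show ?case by (intro bexI[of _ "\<lambda>z. 0"]) (auto intro: polys.const)
next
  case (gen y)
  then show ?case using assms by auto
next
  case (add p q)
  then obtain p' q' where *: "p' \<in> polys W" "q' \<in> polys W" "\<forall>z\<in>D. deriv p z = p' z"
    "\<forall>z\<in>D. deriv q z = q' z" by blast
  have "p field_differentiable at z" "q field_differentiable at z" if "z \<in> D" for z
    using polys_holomorphic[OF add.hyps(1)] polys_holomorphic[OF add.hyps(2)] assms that
    by (auto intro: holomorphic_on_imp_differentiable_at)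
  with * show ?case
    by (intro bexI[of _ "\<lambda>z. p' z + q' z"] polys.add) auto
next
  case (mult p q)
  then obtain p' q' where *: "p' \<in> polys W" "q' \<in> polys W" "\<forall>z\<in>D. deriv p z = p' z"
    "\<forall>z\<in>D. deriv q z = q' z" by blast
  have d: "p field_differentiable at z" "q field_differentiable at z" if "z \<in> D" for z
    using polys_holomorphic[OF mult.hyps(1)] polys_holomorphic[OF mult.hyps(2)] assms that
    by (auto intro: holomorphic_on_imp_differentiable_at)
  have "p \<in> polys W" "q \<in> polys W"
    using mult.hyps polys_mono assms(3) by blast+
  with * show ?case
    by (intro bexI[of _ "\<lambda>z. p z * q' z + p' z * q z"] polys_ops) (auto simp: d)
qed

text \<open>An autonomous polynomial system: the variable z enters as one more generator when it is
  needed. Generators are total functions, but holomorphy and the differential equations are asked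
  only on \<open>D\<close>.\<close>

definition dsys :: "complex set \<Rightarrow> (complex \<Rightarrow> complex) set \<Rightarrow> bool" where
  "dsys D Y \<longleftrightarrow> open D \<and> connected D \<and> D \<noteq> {} \<and> finite Y \<and>
     (\<forall>y\<in>Y. y holomorphic_on D \<and> (\<exists>q\<in>polys Y. \<forall>z\<in>D. deriv y z = q z))"

lemma dsysD:
  assumes "dsys D Y"
  shows "open D" "connected D" "D \<noteq> {}" "finite Y" "y \<in> Y \<Longrightarrow> y holomorphic_on D"
    "y \<in> Y \<Longrightarrow> \<exists>q\<in>polys Y. \<forall>z\<in>D. deriv y z = q z"
  using assms by (auto simp: dsys_def)

lemma dsys_polys_holomorphic: "dsys D Y \<Longrightarrow> p \<in> polys Y \<Longrightarrow> p holomorphic_on D"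
  by (auto intro: polys_holomorphic dsysD)

lemma dsys_polys_deriv: "dsys D Y \<Longrightarrow> p \<in> polys Y \<Longrightarrow> \<exists>q\<in>polys Y. \<forall>z\<in>D. deriv p z = q z"
  by (rule polys_deriv[of p Y D Y]) (auto dest: dsysD)

lemma dsys_subset:
  assumes "dsys D Y" "D' \<subseteq> D" "open D'" "connected D'" "D' \<noteq> {}"
  shows "dsys D' Y"
  using assms unfolding dsys_def by (meson holomorphic_on_subset subsetD)

text \<open>Several functions enter at once because their derivatives may involve each
  other.\<close>

lemma dsys_union:
  assumes "dsys D Y" "finite Z"
    "\<And>y. y \<in> Z \<Longrightarrow> y holomorphic_on D"
    "\<And>y. y \<in> Z \<Longrightarrow> \<exists>q\<in>polys (Z \<union> Y). \<forall>z\<in>D. deriv y z = q z"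
  shows "dsys D (Z \<union> Y)"
  unfolding dsys_def
proof (intro conjI ballI)
  fix y assume y: "y \<in> Z \<union> Y"
  show "y holomorphic_on D" using y assms by (auto dest: dsysD)
  show "\<exists>q\<in>polys (Z \<union> Y). \<forall>z\<in>D. deriv y z = q z"
  proof (cases "y \<in> Z")
    case False
    then obtain q where "q \<in> polys Y" "\<forall>z\<in>D. deriv y z = q z"
      using y dsysD(6)[OF assms(1)] by blast
    then show ?thesis using polys_mono[of q Y "Z \<union> Y"] by blast
  qed (use assms in auto)
qed (use assms in \<open>auto dest: dsysD\<close>)

lemma dsys_insert:
  assumes "dsys D Y" "y holomorphic_on D" "q \<in> polys (insert y Y)" "\<And>z. z \<in> D \<Longrightarrow> deriv y z = q z"
  shows "dsys D (insert y Y)"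
  using dsys_union[of D Y "{y}"] assms by auto

lemma holomorphic_deriv_eq:
  assumes "open D" "z \<in> D" "\<And>x. x \<in> D \<Longrightarrow> f x = g x"
  shows "deriv f z = deriv g z"
  by (intro deriv_cong_ev) (use assms eventually_nhds in blast)+

text \<open>Germs are given only up to equality near a point; this makes a generator of a function
  that merely agrees with a polynomial on \<open>D\<close>.\<close>

lemma dsys_insert_polys:
  assumes "dsys D Y" "p \<in> polys Y" "\<And>z. z \<in> D \<Longrightarrow> y z = p z"
  shows "dsys D (insert y Y)"
proof -
  obtain q where q: "q \<in> polys Y" "\<forall>z\<in>D. deriv p z = q z"
    using dsys_polys_deriv[OF assms(1,2)] by blast
  have "deriv y z = q z" if "z \<in> D" for z
    using holomorphic_deriv_eq[of D z y p] assms(3) that q(2) dsysD(1)[OF assms(1)] by auto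
  moreover have "y holomorphic_on D"
    using dsys_polys_holomorphic[OF assms(1,2)] assms(3) by (simp cong: holomorphic_cong)
  ultimately show ?thesis
    using q(1) by (intro dsys_insert[OF assms(1), of y q]) (auto intro: polys_insert)
qed

section \<open>Adjoining quotients, exponentials, logarithms and primitives\<close>

lemma nonzero_subball:
  assumes "dsys D Y" "p \<in> polys Y" "\<exists>z\<in>D. p z \<noteq> 0"
  obtains D' where "D' \<subseteq> D" "dsys D' Y" "\<And>z. z \<in> D' \<Longrightarrow> p z \<noteq> 0"
proof -
  obtain z where z: "z \<in> D" "p z \<noteq> 0" using assms(3) by blast
  have "open (D \<inter> p -` (- {0}))"
    using dsysD(1)[OF assms(1)] dsys_polys_holomorphic[OF assms(1,2)]
    by (intro continuous_open_preimage) (auto intro: holomorphic_on_imp_continuous_on)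
  moreover have "z \<in> D \<inter> p -` (- {0})" using z by simp
  ultimately obtain e where e: "e > 0" "ball z e \<subseteq> D \<inter> p -` (- {0})"
    unfolding open_contains_ball by blast
  show ?thesis
    by (rule that[of "ball z e"]) (use e in \<open>auto intro!: dsys_subset[OF assms(1)]\<close>)
qed

lemma dsys_insert_inverse:
  assumes "dsys D Y" "p \<in> polys Y" "\<And>z. z \<in> D \<Longrightarrow> p z \<noteq> 0"
  shows "dsys D (insert (\<lambda>z. 1 / p z) Y)"
proof -
  obtain q where q: "q \<in> polys Y" "\<forall>z\<in>D. deriv p z = q z"
    using dsys_polys_deriv[OF assms(1,2)] by blast
  have h: "p holomorphic_on D" using dsys_polys_holomorphic[OF assms(1,2)] .
  let ?u = "\<lambda>z. 1 / p z"
  have "deriv ?u z = - (q z * (?u z * ?u z))" if "z \<in> D" for z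
  proof -
    have "p field_differentiable at z"
      using h that dsysD(1)[OF assms(1)] by (auto intro: holomorphic_on_imp_differentiable_at)
    then have "(p has_field_derivative q z) (at z)"
      using q(2) that DERIV_deriv_iff_field_differentiable by metis
    then have "(?u has_field_derivative - (q z * (?u z * ?u z))) (at z)"
      using assms(3)[OF that] by (auto intro!: derivative_eq_intros)
    then show ?thesis by (rule DERIV_imp_deriv)
  qed
  moreover have "(\<lambda>z. - (q z * (?u z * ?u z))) \<in> polys (insert ?u Y)"
    using polys_insert[OF q(1), of ?u] by (intro polys_ops) (auto intro: polys.gen)
  ultimately show ?thesis
    using h assms by (intro dsys_insert[OF assms(1), of ?u]) (auto intro!: holomorphic_intros)
qed

text \<open>If \<open>q\<close> is somewhere nonzero, its inverse becomes a generator after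
  shrinking \<open>D\<close>. Otherwise division by zero makes \<open>y\<close> the constant 0 on
  \<open>D\<close>.\<close>

lemma dsys_insert_quotient:
  assumes "dsys D Y" "p \<in> polys Y" "q \<in> polys Y" "\<And>z. z \<in> D \<Longrightarrow> y z = p z / q z"
  shows "\<exists>D' Y'. D' \<subseteq> D \<and> Y \<subseteq> Y' \<and> dsys D' Y' \<and> y \<in> Y'"
proof (cases "\<exists>z\<in>D. q z \<noteq> 0")
  case True
  then obtain D' where D': "D' \<subseteq> D" "dsys D' Y" "\<And>z. z \<in> D' \<Longrightarrow> q z \<noteq> 0"
    using nonzero_subball[OF assms(1,3)] by blast
  let ?Z = "insert (\<lambda>z. 1 / q z) Y"
  have "dsys D' ?Z" using dsys_insert_inverse[OF D'(2) assms(3)] D'(3) by blast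
  moreover have "(\<lambda>z. p z * (1 / q z)) \<in> polys ?Z"
    using polys.mult[OF polys_insert[OF assms(2)] polys.gen[of "\<lambda>z. 1 / q z" ?Z]] by auto
  ultimately have "dsys D' (insert y ?Z)"
    by (rule dsys_insert_polys) (use assms(4) D'(1) in auto)
  then show ?thesis using D'(1) by (intro exI[of _ D'] exI[of _ "insert y ?Z"]) auto
next
  case False
  then have "dsys D (insert y Y)"
    by (intro dsys_insert_polys[OF assms(1) polys.const[of 0]]) (use assms(4) in auto)
  then show ?thesis by blast
qed

lemma dsys_insert_exp:
  assumes "dsys D Y" "g \<in> polys Y" "\<And>z. z \<in> D \<Longrightarrow> y z = exp (g z)"
  shows "dsys D (insert y Y)"
proof -
  obtain q where q: "q \<in> polys Y" "\<forall>z\<in>D. deriv g z = q z"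
    using dsys_polys_deriv[OF assms(1,2)] by blast
  have h: "g holomorphic_on D" using dsys_polys_holomorphic[OF assms(1,2)] .
  have "deriv y z = q z * y z" if "z \<in> D" for z
  proof -
    have "g field_differentiable at z"
      using h that dsysD(1)[OF assms(1)] by (auto intro: holomorphic_on_imp_differentiable_at)
    then have "(g has_field_derivative q z) (at z)"
      using q(2) that DERIV_deriv_iff_field_differentiable by metis
    then have "((\<lambda>z. exp (g z)) has_field_derivative q z * y z) (at z)"
      using assms(3)[OF that] by (auto intro!: derivative_eq_intros)
    then have "deriv (\<lambda>z. exp (g z)) z = q z * y z" by (rule DERIV_imp_deriv)
    then show ?thesis
      using holomorphic_deriv_eq[of D z y] that assms(3) dsysD(1)[OF assms(1)] by metis
  qed
  moreover have "(\<lambda>z. q z * y z) \<in> polys (insert y Y)"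
    using polys_insert[OF q(1), of y] by (intro polys_ops) (auto intro: polys.gen)
  moreover have "(\<lambda>z. exp (g z)) holomorphic_on D" using h by (intro holomorphic_intros)
  then have "y holomorphic_on D" using assms(3) by (simp cong: holomorphic_cong)
  ultimately show ?thesis
    by (intro dsys_insert[OF assms(1), of y "\<lambda>z. q z * y z"]) auto
qed

text \<open>The equation is y' = g' / g, and \<open>g\<close> has no zeros on \<open>D\<close>
  because it is an exponential there.\<close>

lemma dsys_insert_log:
  assumes "dsys D Y" "g \<in> polys Y" "y holomorphic_on D" "\<And>z. z \<in> D \<Longrightarrow> exp (y z) = g z"
  shows "\<exists>D' Y'. D' \<subseteq> D \<and> Y \<subseteq> Y' \<and> dsys D' Y' \<and> y \<in> Y'"
proof -
  obtain q where q: "q \<in> polys Y" "\<forall>z\<in>D. deriv g z = q z"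
    using dsys_polys_deriv[OF assms(1,2)] by blast
  have nz: "g z \<noteq> 0" if "z \<in> D" for z using assms(4)[OF that] by (metis exp_not_eq_zero)
  let ?u = "\<lambda>z. 1 / g z" 
  let ?Z = "insert ?u Y"
  have Z: "dsys D ?Z" by (rule dsys_insert_inverse[OF assms(1,2) nz])
  have "deriv y z = q z * ?u z" if "z \<in> D" for z
  proof -
    have "y field_differentiable at z"
      using assms(3) that dsysD(1)[OF assms(1)] by (auto intro: holomorphic_on_imp_differentiable_at)
    then have "(y has_field_derivative deriv y z) (at z)"
      using DERIV_deriv_iff_field_differentiable by metis
    then have "((\<lambda>z. exp (y z)) has_field_derivative g z * deriv y z) (at z)"
      using assms(4)[OF that] by (auto intro!: derivative_eq_intros)
    then have "deriv (\<lambda>z. exp (y z)) z = g z * deriv y z" by (rule DERIV_imp_deriv)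
    moreover have "deriv (\<lambda>z. exp (y z)) z = q z"
      using holomorphic_deriv_eq[of D z "\<lambda>z. exp (y z)" g] that assms(4) dsysD(1)[OF assms(1)] q(2)
      by metis
    ultimately show ?thesis using nz[OF that] by (simp add: field_simps)
  qed
  moreover have "(\<lambda>z. q z * ?u z) \<in> polys (insert y ?Z)"
    using polys_mono[OF q(1), of "insert y ?Z"] by (intro polys_ops) (auto intro: polys.gen)
  ultimately have "dsys D (insert y ?Z)"
    by (intro dsys_insert[OF Z assms(3)]) auto
  then show ?thesis by (intro exI[of _ D] exI[of _ "insert y ?Z"]) auto
qed

lemma dsys_insert_antideriv:
  assumes "dsys D Y" "g \<in> polys Y" "\<And>z. z \<in> D \<Longrightarrow> (y has_field_derivative g z) (at z)"
  shows "dsys D (insert y Y)"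
proof (rule dsys_insert[OF assms(1)])
  show "y holomorphic_on D"
    using assms(3) dsysD(1)[OF assms(1)] by (auto simp: holomorphic_on_open)
  show "g \<in> polys (insert y Y)" using polys_insert[OF assms(2)] .
  show "deriv y z = g z" if "z \<in> D" for z using DERIV_imp_deriv[OF assms(3)[OF that]] .
qed

text \<open>For a relation of minimal degree \<open>d\<close> the formal derivative of the relation with respect to \<open>y\<close>
  does not vanish identically at \<open>y\<close>, so that one can solve for \<open>y'\<close>.\<close>

lemma dsys_insert_algebraic:
  assumes sys: "dsys D Y" and hol: "y holomorphic_on D"
    and a: "\<And>k. k \<le> d \<Longrightarrow> a k \<in> polys Y" "\<exists>k\<le>d. \<exists>z\<in>D. a k z \<noteq> 0"
    and rel: "\<And>z. z \<in> D \<Longrightarrow> (\<Sum>k\<le>(d::nat). a k z * y z ^ k) = 0"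
  shows "\<exists>D' Y'. D' \<subseteq> D \<and> Y \<subseteq> Y' \<and> dsys D' Y' \<and> y \<in> Y'"
proof -
  define P where "P d a \<longleftrightarrow> (\<forall>k\<le>d. a k \<in> polys Y) \<and> (\<exists>k\<le>d. \<exists>z\<in>D. a k z \<noteq> 0) \<and>
     (\<forall>z\<in>D. (\<Sum>k\<le>(d::nat). a k z * y z ^ k) = 0)" for d a
  define m where "m = (LEAST d. \<exists>a. P d a)"
  have "\<exists>a. P m a"
    unfolding m_def by (rule LeastI[of _ d]) (use assms in \<open>auto simp: P_def\<close>)
  then obtain b where b: "P m b" by blast
  have min: "\<not> P k c" if "k < m" for k c
    using not_less_Least[of k "\<lambda>d. \<exists>a. P d a"] that by (auto simp: m_def)
  have op: "open D" using dsysD(1)[OF sys] .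
  obtain l where m: "m = Suc l"
  proof (cases m)
    case 0
    then show ?thesis using b by (auto simp: P_def)
  qed auto
  have lead: "\<exists>z\<in>D. b m z \<noteq> 0"
  proof (rule ccontr)
    assume "\<not> ?thesis"
    then have z: "\<forall>z\<in>D. b (Suc l) z = 0" using m by auto
    then have "P l b"
      using b unfolding P_def m by (auto simp: le_Suc_eq)
    then show False using min[of l b] m by auto
  qed
  \<comment> \<open>The formal derivative with respect to \<open>y\<close>. Its top coefficient is a
    nonzero multiple of the leading coefficient \<open>b m\<close>, so its vanishing at
    \<open>y\<close> would be a nontrivial relation of degree l < m.\<close>
  define Q where "Q = (\<lambda>z. \<Sum>k\<le>l. (of_nat (Suc k) * b (Suc k) z) * y z ^ k)"
  have "\<exists>z\<in>D. Q z \<noteq> 0"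
  proof (rule ccontr)
    assume "\<not> ?thesis"
    then have "P l (\<lambda>k z. of_nat (Suc k) * b (Suc k) z)"
      using b lead unfolding P_def m Q_def
      by (auto intro!: polys_ops exI[of _ l] simp del: of_nat_Suc)
    then show False using min m by auto
  qed
  let ?W = "insert y Y"
  have bW: "b k \<in> polys ?W" if "k \<le> m" for k using b that by (auto simp: P_def intro: polys_insert)
  have yW: "y \<in> polys ?W" by (auto intro: polys.gen)
  have holW: "h holomorphic_on D" if "h \<in> ?W" for h using that hol dsysD(5)[OF sys] by auto
  have QW: "Q \<in> polys ?W"
    unfolding Q_def by (intro polys_ops bW yW) (auto simp: m)
  have Qh: "Q holomorphic_on D" using polys_holomorphic[OF QW holW] .
  obtain D' where D': "D' \<subseteq> D" "open D'" "connected D'" "D' \<noteq> {}" "\<And>z. z \<in> D' \<Longrightarrow> Q z \<noteq> 0"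
  proof -
    obtain z where z: "z \<in> D" "Q z \<noteq> 0" using \<open>\<exists>z\<in>D. Q z \<noteq> 0\<close> by blast
    have "open (D \<inter> Q -` (- {0}))"
      using op Qh by (intro continuous_open_preimage) (auto intro: holomorphic_on_imp_continuous_on)
    moreover have "z \<in> D \<inter> Q -` (- {0})" using z by simp
    ultimately obtain e where e: "e > 0" "ball z e \<subseteq> D \<inter> Q -` (- {0})"
      unfolding open_contains_ball by blast
    show ?thesis
      by (rule that[of "ball z e"]) (use e in auto)
  qed
  have sys': "dsys D' Y" using dsys_subset[OF sys D'(1-4)] .
  have "\<exists>b'. \<forall>k\<le>m. b' k \<in> polys Y \<and> (\<forall>z\<in>D. deriv (b k) z = b' k z)"
  proof -
    have "\<forall>k. \<exists>c. k \<le> m \<longrightarrow> c \<in> polys Y \<and> (\<forall>z\<in>D. deriv (b k) z = c z)"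
      using dsys_polys_deriv[OF sys] b unfolding P_def by meson
    then show ?thesis by metis
  qed
  then obtain b' where b': "\<And>k. k \<le> m \<Longrightarrow> b' k \<in> polys Y"
    "\<And>k z. k \<le> m \<Longrightarrow> z \<in> D \<Longrightarrow> deriv (b k) z = b' k z" by blast
  define u where "u = (\<lambda>z. 1 / Q z)"
  define S where "S = (\<lambda>z. \<Sum>k\<le>m. b' k z * y z ^ k)"
  \<comment> \<open>Differentiating the relation gives S + Q y' = 0, where \<open>S\<close> collects
    the derivatives of the coefficients.\<close>
  have dy: "deriv y z = - (S z * u z)" if z: "z \<in> D'" for z
  proof -
    have zD: "z \<in> D" using z D' by auto
    have y': "(y has_field_derivative deriv y z) (at z)"
      using hol op zD holomorphic_derivI by blast
    have "((\<lambda>z. \<Sum>k\<le>m. b k z * y z ^ k) has_field_derivative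
        (\<Sum>k\<le>m. b' k z * y z ^ k + (of_nat k * (y z ^ (k - 1) * deriv y z)) * b k z)) (at z)"
    proof (intro DERIV_sum DERIV_mult)
      fix k assume "k \<in> {..m}"
      then have "b k holomorphic_on D"
        using b by (intro dsys_polys_holomorphic[OF sys]) (auto simp: P_def)
      then show "(b k has_field_derivative b' k z) (at z)"
        using holomorphic_derivI[OF _ op zD] b'(2)[OF _ zD, of k] \<open>k \<in> {..m}\<close> by fastforce
      show "((\<lambda>z. y z ^ k) has_field_derivative of_nat k * (y z ^ (k - 1) * deriv y z)) (at z)"
        using y' by (auto intro!: derivative_eq_intros)
    qed
    then have "deriv (\<lambda>z. \<Sum>k\<le>m. b k z * y z ^ k) z =
       (\<Sum>k\<le>m. b' k z * y z ^ k + (of_nat k * (y z ^ (k - 1) * deriv y z)) * b k z)"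
      by (rule DERIV_imp_deriv)
    moreover have "deriv (\<lambda>z. \<Sum>k\<le>m. b k z * y z ^ k) z = deriv (\<lambda>z. 0) z"
      using b by (intro holomorphic_deriv_eq[OF op zD]) (auto simp: P_def)
    ultimately have "S z + (\<Sum>k\<le>m. (of_nat k * (y z ^ (k - 1) * deriv y z)) * b k z) = 0"
      by (simp add: S_def sum.distrib)
    moreover have "(\<Sum>k\<le>m. (of_nat k * (y z ^ (k - 1) * deriv y z)) * b k z) = Q z * deriv y z"
      unfolding m Q_def sum_distrib_right
      by (subst sum.atMost_Suc_shift) (auto intro!: sum.cong simp: algebra_simps)
    ultimately have "Q z * deriv y z = - S z" by (simp add: add_eq_0_iff)
    then show ?thesis using D'(5)[OF z] by (simp add: u_def field_simps)
  qed
  \<comment> \<open>y' involves \<open>u\<close>, and u' = - Q' u^2 involves \<open>y\<close>, so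
    both are adjoined together.\<close>
  let ?Z = "{y, u} \<union> Y"
  have Z: "h \<in> polys Y \<Longrightarrow> h \<in> polys ?Z" "h \<in> polys ?W \<Longrightarrow> h \<in> polys ?Z" for h
    by (auto elim: polys_mono)
  have yuZ: "y \<in> polys ?Z" "u \<in> polys ?Z" by (auto intro: polys.gen)
  have SZ: "(\<lambda>z. - (S z * u z)) \<in> polys ?Z"
    unfolding S_def by (intro polys_ops yuZ Z b') auto
  have "\<exists>q\<in>polys ?Z. \<forall>z\<in>D'. deriv Q z = q z"
  proof (rule polys_deriv[OF QW D'(2)])
    fix h assume h: "h \<in> ?W"
    show "h holomorphic_on D'" using holW[OF h] D'(1) holomorphic_on_subset by blast
    show "\<exists>q\<in>polys ?Z. \<forall>z\<in>D'. deriv h z = q z"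
    proof (cases "h = y")
      case True
      then show ?thesis by (intro bexI[OF _ SZ]) (simp add: dy)
    next
      case False
      then obtain q where "q \<in> polys Y" "\<forall>z\<in>D'. deriv h z = q z"
        using dsysD(6)[OF sys', of h] h by auto
      then show ?thesis by (intro bexI[OF _ Z(1)])
    qed
  qed auto
  then obtain q where q: "q \<in> polys ?Z" "\<forall>z\<in>D'. deriv Q z = q z" by blast
  have du: "deriv u z = - (q z * (u z * u z))" if z: "z \<in> D'" for z
  proof -
    have "(Q has_field_derivative q z) (at z)"
      using q(2) z D'(1) holomorphic_derivI[OF Qh op] by fastforce
    then have "(u has_field_derivative - (q z * (u z * u z))) (at z)"
      unfolding u_def using D'(5)[OF z] by (auto intro!: derivative_eq_intros)
    then show ?thesis by (rule DERIV_imp_deriv)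
  qed
  have "dsys D' ?Z"
  proof (rule dsys_union[OF sys'])
    fix h assume h: "h \<in> {y, u}"
    have "u holomorphic_on D'"
      unfolding u_def using D' by (auto intro!: holomorphic_intros holomorphic_on_subset[OF Qh])
    then show "h holomorphic_on D'" using h hol D'(1) holomorphic_on_subset by blast
    have uZ: "(\<lambda>z. - (q z * (u z * u z))) \<in> polys ?Z" by (intro polys_ops q yuZ)
    show "\<exists>q\<in>polys ?Z. \<forall>z\<in>D'. deriv h z = q z"
    proof (cases "h = y")
      case True
      then show ?thesis by (intro bexI[OF _ SZ]) (simp add: dy)
    next
      case False
      then show ?thesis using h by (intro bexI[OF _ uZ]) (simp add: du)
    qed
  qed auto
  then show ?thesis using D'(1) by (intro exI[of _ D'] exI[of _ ?Z]) auto
qed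

text \<open>Quartics are the shape met below for inverse trigonometric functions: a quadratic in
  \<open>e\<close>, possibly multiplied by e^2 + 1 or e^2 - 1.\<close>

lemma dsys_insert_algebraic4:
  assumes sys: "dsys D Y" and hol: "y holomorphic_on D"
    and a: "a0 \<in> polys Y" "a1 \<in> polys Y" "a2 \<in> polys Y" "a3 \<in> polys Y" "a4 \<in> polys Y"
    and nz: "\<exists>z\<in>D. a0 z \<noteq> 0 \<or> a1 z \<noteq> 0 \<or> a2 z \<noteq> 0 \<or> a3 z \<noteq> 0 \<or> a4 z \<noteq> 0"
    and rel: "\<And>z. z \<in> D \<Longrightarrow> a4 z * y z ^ 4 + a3 z * y z ^ 3 + a2 z * y z ^ 2 + a1 z * y z + a0 z = 0"
  shows "\<exists>D' Y'. D' \<subseteq> D \<and> Y \<subseteq> Y' \<and> dsys D' Y' \<and> y \<in> Y'"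
proof (rule dsys_insert_algebraic[OF sys hol, of 4 "\<lambda>k. [a0, a1, a2, a3, a4] ! k"])
  have le4: "k \<le> 4 \<longleftrightarrow> k = 0 \<or> k = 1 \<or> k = 2 \<or> k = 3 \<or> k = 4" for k :: nat by linarith
  show "[a0, a1, a2, a3, a4] ! k \<in> polys Y" if "k \<le> 4" for k
    using that a unfolding le4 by (auto simp: numeral_eq_Suc)
  show "\<exists>k\<le>4. \<exists>z\<in>D. ([a0, a1, a2, a3, a4] ! k) z \<noteq> 0"
  proof (rule ccontr)
    assume "\<not> ?thesis"
    then have z: "([a0, a1, a2, a3, a4] ! k) z = 0" if "k \<le> 4" "z \<in> D" for k z
      using that by blast
    show False using nz z[of 0] z[of 1] z[of 2] z[of 3] z[of 4] by auto
  qed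
  show "(\<Sum>k\<le>4. ([a0, a1, a2, a3, a4] ! k) z * y z ^ k) = 0" if "z \<in> D" for z
    using rel[OF that] by (simp add: numeral_eq_Suc algebra_simps)
qed

section \<open>Representable germs\<close>

text \<open>The open set \<open>N\<close> need not contain \<open>c\<close>: denominators may vanish at \<open>c\<close>, so the differential
  system is only found on some small set near \<open>c\<close>.\<close>

definition good_germs :: "complex \<Rightarrow> (complex \<Rightarrow> complex) set \<Rightarrow> bool" where
  "good_germs c G \<longleftrightarrow> (\<exists>r>0. (\<forall>g\<in>G. g holomorphic_on ball c r) \<and>
     (\<forall>N. open N \<and> N \<noteq> {} \<and> N \<subseteq> ball c r \<longrightarrow> (\<exists>D Y. D \<subseteq> N \<and> dsys D Y \<and> G \<subseteq> Y)))"

lemma good_germs_subset: "good_germs c G \<Longrightarrow> H \<subseteq> G \<Longrightarrow> good_germs c H"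
  unfolding good_germs_def by (meson subset_trans subsetD)

lemma good_germs_analytic: "good_germs c G \<Longrightarrow> g \<in> G \<Longrightarrow> g analytic_on {c}"
  unfolding good_germs_def analytic_on_def by auto

lemma good_germs_empty: "good_germs c {}"
  unfolding good_germs_def
proof (intro exI[of _ "1::real"] conjI allI impI)
  fix N assume N: "open N \<and> N \<noteq> {} \<and> N \<subseteq> ball c 1"
  then obtain z e where "e > 0" "ball z e \<subseteq> N" by (meson all_not_in_conv open_contains_ball)
  then show "\<exists>D Y. D \<subseteq> N \<and> dsys D Y \<and> {} \<subseteq> Y"
    by (intro exI[of _ "ball z e"] exI[of _ "{}"]) (auto simp: dsys_def)
qed auto

text \<open>The identity theorem carries nonvanishing from \<open>c\<close> to a small open set that
  may lie away from \<open>c\<close>.\<close>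

lemma not_germ_zero:
  assumes "g holomorphic_on ball c r" "r > 0" "\<not> germ_eq c g (\<lambda>z. 0)" "open D" "D \<noteq> {}" "D \<subseteq> ball c r"
  shows "\<exists>z\<in>D. g z \<noteq> 0"
proof (rule ccontr)
  assume *: "\<not> ?thesis"
  have "g z = 0" if "z \<in> ball c r" for z
    by (rule analytic_continuation_open[of D "ball c r" g "\<lambda>z. 0"]) (use assms that * in auto)
  moreover have "\<forall>\<^sub>F z in nhds c. z \<in> ball c r"
    using assms(2) by (intro eventually_nhds_in_open) auto
  ultimately have "germ_eq c g (\<lambda>z. 0)"
    unfolding germ_eq_def by (auto elim: eventually_mono)
  then show False using assms(3) by contradiction
qed

text \<open>Reduces one action on germs to an extension of a differential system: in
  \<open>step\<close> the defining relation \<open>R\<close> holds everywhere on \<open>D\<close>,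
  and germs that are nonzero at \<open>c\<close> are known not to vanish identically on
  \<open>D\<close>.\<close>

lemma good_germs_insert:
  assumes G: "good_germs c G" and an: "\<phi> analytic_on {c}" and ev: "\<forall>\<^sub>F z in at c. R z"
    and step: "\<And>D Y. dsys D Y \<Longrightarrow> G \<subseteq> Y \<Longrightarrow> \<phi> holomorphic_on D \<Longrightarrow> (\<And>z. z \<in> D \<Longrightarrow> R z) \<Longrightarrow>
      (\<And>g. g \<in> G \<Longrightarrow> \<not> germ_eq c g (\<lambda>z. 0) \<Longrightarrow> \<exists>z\<in>D. g z \<noteq> 0) \<Longrightarrow>
      \<exists>D' Y'. D' \<subseteq> D \<and> Y \<subseteq> Y' \<and> dsys D' Y' \<and> \<phi> \<in> Y'"
  shows "good_germs c (insert \<phi> G)"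
proof -
  obtain r where r: "r > 0" "\<forall>g\<in>G. g holomorphic_on ball c r"
    "\<And>N. open N \<Longrightarrow> N \<noteq> {} \<Longrightarrow> N \<subseteq> ball c r \<Longrightarrow> \<exists>D Y. D \<subseteq> N \<and> dsys D Y \<and> G \<subseteq> Y"
    using G unfolding good_germs_def by auto
  obtain s where s: "s > 0" "\<phi> holomorphic_on ball c s"
    using an by (auto simp: analytic_on_def)
  obtain t where t: "t > 0" "\<And>z. z \<noteq> c \<Longrightarrow> dist z c < t \<Longrightarrow> R z"
    using ev by (auto simp: eventually_at)
  define m where "m = Min {r, s, t}"
  have m: "m > 0" "m \<le> r" "m \<le> s" "m \<le> t" using r s t by (auto simp: m_def)
  show ?thesis
    unfolding good_germs_def
  proof (intro exI[of _ m] conjI allI impI ballI)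
    show "m > 0" by (fact m)
    fix g assume "g \<in> insert \<phi> G"
    then show "g holomorphic_on ball c m"
      using r(2) s(2) m holomorphic_on_subset subset_ball by (metis insert_iff)
  next
    fix N assume N: "open N \<and> N \<noteq> {} \<and> N \<subseteq> ball c m"
    \<comment> \<open>\<open>R\<close> is known only off \<open>c\<close>. An open set is not a
      single point, so removing \<open>c\<close> leaves a nonempty open set.\<close>
    have "N \<noteq> {c}" using N not_open_singleton[of c] by auto
    then have "N - {c} \<noteq> {}" using N by blast
    moreover have "open (N - {c})" using N by (auto intro: open_delete)
    moreover have "N - {c} \<subseteq> ball c r" using N m by auto
    ultimately obtain D Y where D: "D \<subseteq> N - {c}" "dsys D Y" "G \<subseteq> Y"
      using r(3)[of "N - {c}"] by auto
    have Dm: "D \<subseteq> ball c m" using D N by auto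
    have "\<exists>D' Y'. D' \<subseteq> D \<and> Y \<subseteq> Y' \<and> dsys D' Y' \<and> \<phi> \<in> Y'"
    proof (rule step[OF D(2,3)])
      show "\<phi> holomorphic_on D"
        by (rule holomorphic_on_subset[OF s(2)]) (use Dm m(3) in auto)
      show "R z" if "z \<in> D" for z
      proof (rule t(2))
        show "z \<noteq> c" "dist z c < t" using that D(1) Dm m(4) by (auto simp: dist_commute)
      qed
      show "\<exists>z\<in>D. g z \<noteq> 0" if "g \<in> G" "\<not> germ_eq c g (\<lambda>z. 0)" for g
        by (rule not_germ_zero[OF _ r(1) that(2) dsysD(1,3)[OF D(2)]])
          (use r(2) that(1) Dm m(2) in auto)
    qed
    then obtain D' Y' where D': "D' \<subseteq> D" "Y \<subseteq> Y'" "dsys D' Y'" "\<phi> \<in> Y'" by auto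
    show "\<exists>D Y. D \<subseteq> N \<and> dsys D Y \<and> insert \<phi> G \<subseteq> Y"
      by (intro exI[of _ D'] exI[of _ Y']) (use D D' in auto)
  qed
qed

lemma eventually_nhds_at: "\<forall>\<^sub>F z in nhds c. R z \<Longrightarrow> \<forall>\<^sub>F z in at c. R z"
  by (simp add: eventually_nhds_conv_at)

lemma eventually_compose_analytic:
  assumes "g analytic_on {c}" "\<forall>\<^sub>F w in nhds (g c). R w"
  shows "\<forall>\<^sub>F z in nhds c. R (g z)"
proof -
  have "isCont g c"
    using assms(1) analytic_at_imp_isCont by blast
  then have "filterlim g (nhds (g c)) (nhds c)"
    by (simp add: isCont_def tendsto_at_iff_tendsto_nhds)
  then show ?thesis by (rule eventually_compose_filterlim[OF assms(2)])
qed

lemma extend_insert: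
  "dsys D (insert y Y) \<Longrightarrow> \<exists>D' Y'. D' \<subseteq> D \<and> Y \<subseteq> Y' \<and> dsys D' Y' \<and> y \<in> Y'"
  by (intro exI[of _ D] exI[of _ "insert y Y"]) auto

lemma good_germs_log:
  assumes "good_germs c G" "g \<in> G" "\<phi> analytic_on {c}" "\<forall>\<^sub>F z in nhds c. exp (\<phi> z) = g z"
  shows "good_germs c (insert \<phi> G)"
proof (rule good_germs_insert[OF assms(1,3) eventually_nhds_at[OF assms(4)]])
  fix D Y
  assume D: "dsys D Y" "G \<subseteq> Y" "\<phi> holomorphic_on D" "\<And>z. z \<in> D \<Longrightarrow> exp (\<phi> z) = g z"
  have "g \<in> polys Y" using assms(2) D(2) by (auto intro: polys.gen)
  from dsys_insert_log[OF D(1) this D(3,4)]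
  show "\<exists>D' Y'. D' \<subseteq> D \<and> Y \<subseteq> Y' \<and> dsys D' Y' \<and> \<phi> \<in> Y'" .
qed

lemma good_germs_polys:
  assumes "good_germs c G" "p \<in> polys G" "\<phi> analytic_on {c}" "\<forall>\<^sub>F z in nhds c. \<phi> z = p z"
  shows "good_germs c (insert \<phi> G)"
proof (rule good_germs_insert[OF assms(1,3) eventually_nhds_at[OF assms(4)]])
  fix D Y assume D: "dsys D Y" "G \<subseteq> Y" "\<And>z. z \<in> D \<Longrightarrow> \<phi> z = p z"
  show "\<exists>D' Y'. D' \<subseteq> D \<and> Y \<subseteq> Y' \<and> dsys D' Y' \<and> \<phi> \<in> Y'"
    by (rule extend_insert[OF dsys_insert_polys[OF D(1) polys_mono[OF assms(2) D(2)] D(3)]])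
qed

lemma good_germs_exp:
  assumes "good_germs c G" "p \<in> polys G" "\<phi> analytic_on {c}" "\<forall>\<^sub>F z in nhds c. \<phi> z = exp (p z)"
  shows "good_germs c (insert \<phi> G)"
proof (rule good_germs_insert[OF assms(1,3) eventually_nhds_at[OF assms(4)]])
  fix D Y assume D: "dsys D Y" "G \<subseteq> Y" "\<And>z. z \<in> D \<Longrightarrow> \<phi> z = exp (p z)"
  show "\<exists>D' Y'. D' \<subseteq> D \<and> Y \<subseteq> Y' \<and> dsys D' Y' \<and> \<phi> \<in> Y'"
    by (rule extend_insert[OF dsys_insert_exp[OF D(1) polys_mono[OF assms(2) D(2)] D(3)]])
qed

section \<open>Trigonometric functions and their inverses\<close>

text \<open>Euler's formulas reduce all six functions to quotients of polynomials in
  \<open>E\<close> and \<open>F\<close>.\<close>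

lemma dsys_insert_trig:
  assumes sys: "dsys D Y" and g: "g \<in> polys Y" and T: "T \<in> trig_functions"
    and y: "\<And>z. z \<in> D \<Longrightarrow> y z = T (g z)"
  shows "\<exists>D' Y'. D' \<subseteq> D \<and> Y \<subseteq> Y' \<and> dsys D' Y' \<and> y \<in> Y'"
proof -
  define E where "E = (\<lambda>z. exp (\<i> * g z))"
  define F where "F = (\<lambda>z. exp (- (\<i> * g z)))"
  let ?Y = "insert E (insert F Y)"
  have g': "g \<in> polys (insert F Y)" by (rule polys_insert[OF g])
  have F: "dsys D (insert F Y)"
    using g by (intro dsys_insert_exp[OF sys, of "\<lambda>z. - (\<i> * g z)"] polys_ops) (auto simp: F_def)
  have E: "dsys D ?Y"
    using g' by (intro dsys_insert_exp[OF F, of "\<lambda>z. \<i> * g z"] polys_ops) (auto simp: E_def)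
  have "(\<lambda>z. (E z - F z) * (1 / (2 * \<i>))) \<in> polys ?Y" "(\<lambda>z. (E z + F z) * (1 / 2)) \<in> polys ?Y"
    by (intro polys_ops; auto intro: polys.gen)+
  moreover have "(\<lambda>z. (E z - F z) * (1 / (2 * \<i>))) = (\<lambda>z. sin (g z))"
    "(\<lambda>z. (E z + F z) * (1 / 2)) = (\<lambda>z. cos (g z))"
    by (auto simp: E_def F_def sin_exp_eq cos_exp_eq)
  ultimately have sc: "(\<lambda>z. sin (g z)) \<in> polys ?Y" "(\<lambda>z. cos (g z)) \<in> polys ?Y"
    by simp_all
  have "\<exists>p\<in>polys ?Y. \<exists>q\<in>polys ?Y. \<forall>z. T (g z) = p z / q z"
    using T unfolding trig_functions_def
    by (elim insertE emptyE) (use sc polys.const[of 1] in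
      \<open>force simp: tan_def cot_def intro: bexI[where x="\<lambda>z. 1"]\<close>)+
  then obtain p q where pq: "p \<in> polys ?Y" "q \<in> polys ?Y" "\<And>z. T (g z) = p z / q z" by blast
  have "\<exists>D' Y'. D' \<subseteq> D \<and> ?Y \<subseteq> Y' \<and> dsys D' Y' \<and> y \<in> Y'"
    by (rule dsys_insert_quotient[OF E pq(1,2)]) (use y pq(3) in auto)
  then show ?thesis by blast
qed

text \<open>If \<open>T \<phi> = g\<close>, then \<open>e = exp (\<i> \<phi>)\<close> is algebraic over \<open>g\<close>. For the quotients \<open>T\<close> the equation is
  multiplied by \<open>e\<^sup>2 + 1\<close> or \<open>e\<^sup>2 - 1\<close> to cover the junk value \<open>0\<close> at poles of \<open>T\<close>.\<close>

lemma dsys_insert_exp_inverse_trig: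
  assumes sys: "dsys D Y" and g: "g \<in> Y" and T: "T \<in> trig_functions"
    and E: "(\<lambda>z. exp (\<i> * \<phi> z)) holomorphic_on D"
    and y: "\<And>z. z \<in> D \<Longrightarrow> T (\<phi> z) = g z"
  shows "\<exists>D' Y'. D' \<subseteq> D \<and> Y \<subseteq> Y' \<and> dsys D' Y' \<and> (\<lambda>z. exp (\<i> * \<phi> z)) \<in> Y'"
proof -
  let ?E = "\<lambda>z. exp (\<i> * \<phi> z)"
  have gY: "g \<in> polys Y" using g by (rule polys.gen)
  note c = polys.const
  obtain z0 where z0: "z0 \<in> D" using dsysD(3)[OF sys] by blast
  \<comment> \<open>Euler's formulas, multiplied by exp(i \<phi>) to clear exp(-i \<phi>).\<close>
  have s: "(?E z)\<^sup>2 - 1 = 2 * \<i> * ?E z * sin (\<phi> z)" and c': "(?E z)\<^sup>2 + 1 = 2 * ?E z * cos (\<phi> z)" for z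
    by (simp_all add: sin_exp_eq cos_exp_eq exp_minus field_simps power2_eq_square)
  \<comment> \<open>With \<open>e\<close> abstracted, each case is pure algebra in \<open>e\<close>,
    sine and cosine.\<close>
  have key: ?thesis if "a0 \<in> polys Y" "a1 \<in> polys Y" "a2 \<in> polys Y" "a3 \<in> polys Y" "a4 \<in> polys Y"
    "\<exists>z\<in>D. a0 z \<noteq> 0 \<or> a1 z \<noteq> 0 \<or> a2 z \<noteq> 0 \<or> a3 z \<noteq> 0 \<or> a4 z \<noteq> 0"
    "\<And>z e. z \<in> D \<Longrightarrow> e\<^sup>2 - 1 = 2 * \<i> * e * sin (\<phi> z) \<Longrightarrow> e\<^sup>2 + 1 = 2 * e * cos (\<phi> z) \<Longrightarrow>
      T (\<phi> z) = g z \<Longrightarrow> a4 z * e ^ 4 + a3 z * e ^ 3 + a2 z * e ^ 2 + a1 z * e + a0 z = 0"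
    for a0 a1 a2 a3 a4
    using that(7)[OF _ s c' y] by (intro dsys_insert_algebraic4[OF sys E that(1-6)])
  consider "T = sin" | "T = cos" | "T = tan" | "T = cot" | "T = (\<lambda>w. 1 / cos w)" | "T = (\<lambda>w. 1 / sin w)"
    using T unfolding trig_functions_def by blast
  then show ?thesis
  proof cases
    case 1
    show ?thesis
      by (rule key[of "\<lambda>z. - 1" "\<lambda>z. - 2 * \<i> * g z" "\<lambda>z. 1" "\<lambda>z. 0" "\<lambda>z. 0"])
        (use z0 in \<open>auto intro!: polys_ops gY simp: 1 field_simps power2_eq_square\<close>)
  next
    case 2
    show ?thesis
      by (rule key[of "\<lambda>z. 1" "\<lambda>z. - 2 * g z" "\<lambda>z. 1" "\<lambda>z. 0" "\<lambda>z. 0"])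
        (use z0 in \<open>auto intro!: polys_ops gY simp: 2 field_simps power2_eq_square\<close>)
  next
    case 3
    show ?thesis
    proof (rule key[of "\<lambda>z. - (1 + \<i> * g z)" "\<lambda>z. 0" "\<lambda>z. - 2 * \<i> * g z" "\<lambda>z. 0" "\<lambda>z. 1 - \<i> * g z"])
      \<comment> \<open>\<open>1 + \<i> * g z\<close> and \<open>1 - \<i> * g z\<close> add up to 2,
        so they never vanish together.\<close>
      show "\<exists>z\<in>D. - (1 + \<i> * g z) \<noteq> 0 \<or> 0 \<noteq> (0::complex) \<or> - 2 * \<i> * g z \<noteq> 0 \<or> 0 \<noteq> (0::complex) \<or> 1 - \<i> * g z \<noteq> 0"
        using z0 by (intro bexI[of _ z0]) auto
      fix z e assume h: "e\<^sup>2 - 1 = 2 * \<i> * e * sin (\<phi> z)" "e\<^sup>2 + 1 = 2 * e * cos (\<phi> z)" "T (\<phi> z) = g z"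
      have "(e\<^sup>2 + 1) * ((1 - \<i> * g z) * e\<^sup>2 - (1 + \<i> * g z)) = 0"
      proof (cases "cos (\<phi> z) = 0")
        case True
        then show ?thesis using h(2) by simp
      next
        case False
        then have t: "sin (\<phi> z) = g z * cos (\<phi> z)" using h(3) by (auto simp: 3 tan_def divide_eq_eq)
        have "(1 - \<i> * g z) * e\<^sup>2 - (1 + \<i> * g z) = (e\<^sup>2 - 1) - \<i> * g z * (e\<^sup>2 + 1)"
          by (simp add: algebra_simps)
        also have "\<dots> = 0" unfolding h(1,2) using t by algebra
        finally have "(1 - \<i> * g z) * e\<^sup>2 - (1 + \<i> * g z) = 0" .
        then show ?thesis by simp
      qed
      then show "(1 - \<i> * g z) * e ^ 4 + 0 * e ^ 3 + - 2 * \<i> * g z * e\<^sup>2 + 0 * e + - (1 + \<i> * g z) = 0"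
        by algebra
    qed (intro polys_ops gY)+
  next
    case 4
    show ?thesis
    proof (rule key[of "\<lambda>z. - (\<i> + g z)" "\<lambda>z. 0" "\<lambda>z. 2 * g z" "\<lambda>z. 0" "\<lambda>z. \<i> - g z"])
      show "\<exists>z\<in>D. - (\<i> + g z) \<noteq> 0 \<or> 0 \<noteq> (0::complex) \<or> 2 * g z \<noteq> 0 \<or> 0 \<noteq> (0::complex) \<or> \<i> - g z \<noteq> 0"
        using z0 by (intro bexI[of _ z0]) auto
      fix z e assume h: "e\<^sup>2 - 1 = 2 * \<i> * e * sin (\<phi> z)" "e\<^sup>2 + 1 = 2 * e * cos (\<phi> z)" "T (\<phi> z) = g z"
      have "(e\<^sup>2 - 1) * ((\<i> - g z) * e\<^sup>2 + (\<i> + g z)) = 0"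
      proof (cases "sin (\<phi> z) = 0")
        case True
        then show ?thesis using h(1) by simp
      next
        case False
        then have t: "cos (\<phi> z) = g z * sin (\<phi> z)" using h(3) by (auto simp: 4 cot_def divide_eq_eq)
        have "(\<i> - g z) * e\<^sup>2 + (\<i> + g z) = \<i> * (e\<^sup>2 + 1) - g z * (e\<^sup>2 - 1)"
          by (simp add: algebra_simps)
        also have "\<dots> = 0" unfolding h(1,2) using t by algebra
        finally have "(\<i> - g z) * e\<^sup>2 + (\<i> + g z) = 0" .
        then show ?thesis by simp
      qed
      then show "(\<i> - g z) * e ^ 4 + 0 * e ^ 3 + 2 * g z * e\<^sup>2 + 0 * e + - (\<i> + g z) = 0"
        by algebra
    qed (intro polys_ops gY)+
  next
    case 5
    show ?thesis
    proof (rule key[of "\<lambda>z. g z" "\<lambda>z. - 2" "\<lambda>z. 2 * g z" "\<lambda>z. - 2" "\<lambda>z. g z"])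
      show "\<exists>z\<in>D. g z \<noteq> 0 \<or> - 2 \<noteq> (0::complex) \<or> 2 * g z \<noteq> 0 \<or> - 2 \<noteq> (0::complex) \<or> g z \<noteq> 0"
        using z0 by (intro bexI[of _ z0]) auto
      fix z e assume h: "e\<^sup>2 - 1 = 2 * \<i> * e * sin (\<phi> z)" "e\<^sup>2 + 1 = 2 * e * cos (\<phi> z)" "T (\<phi> z) = g z"
      have "(e\<^sup>2 + 1) * (g z * e\<^sup>2 - 2 * e + g z) = 0"
      proof (cases "cos (\<phi> z) = 0")
        case True
        then show ?thesis using h(2) by simp
      next
        case False
        then have t: "g z * cos (\<phi> z) = 1" using h(3) by (auto simp: 5 divide_eq_eq)
        have "g z * e\<^sup>2 - 2 * e + g z = g z * (e\<^sup>2 + 1) - 2 * e"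
          by (simp add: algebra_simps)
        also have "\<dots> = 0" unfolding h(1,2) using t by algebra
        finally have "g z * e\<^sup>2 - 2 * e + g z = 0" .
        then show ?thesis by simp
      qed
      then show "g z * e ^ 4 + - 2 * e ^ 3 + 2 * g z * e\<^sup>2 + - 2 * e + g z = 0"
        by algebra
    qed (intro polys_ops gY)+
  next
    case 6
    show ?thesis
    proof (rule key[of "\<lambda>z. g z" "\<lambda>z. 2 * \<i>" "\<lambda>z. - 2 * g z" "\<lambda>z. - 2 * \<i>" "\<lambda>z. g z"])
      show "\<exists>z\<in>D. g z \<noteq> 0 \<or> 2 * \<i> \<noteq> 0 \<or> - 2 * g z \<noteq> 0 \<or> - 2 * \<i> \<noteq> 0 \<or> g z \<noteq> 0"
        using z0 by (intro bexI[of _ z0]) auto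
      fix z e assume h: "e\<^sup>2 - 1 = 2 * \<i> * e * sin (\<phi> z)" "e\<^sup>2 + 1 = 2 * e * cos (\<phi> z)" "T (\<phi> z) = g z"
      have "(e\<^sup>2 - 1) * (g z * e\<^sup>2 - 2 * \<i> * e - g z) = 0"
      proof (cases "sin (\<phi> z) = 0")
        case True
        then show ?thesis using h(1) by simp
      next
        case False
        then have t: "g z * sin (\<phi> z) = 1" using h(3) by (auto simp: 6 divide_eq_eq)
        have "g z * e\<^sup>2 - 2 * \<i> * e - g z = g z * (e\<^sup>2 - 1) - 2 * \<i> * e"
          by (simp add: algebra_simps)
        also have "\<dots> = 0" unfolding h(1,2) using t by algebra
        finally have "g z * e\<^sup>2 - 2 * \<i> * e - g z = 0" .
        then show ?thesis by simp
      qed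
      then show "g z * e ^ 4 + - 2 * \<i> * e ^ 3 + - 2 * g z * e\<^sup>2 + 2 * \<i> * e + g z = 0"
        by algebra
    qed (intro polys_ops gY)+
  qed
qed

text \<open>The chain is exp(i \<phi>), which is algebraic over \<open>g\<close>, then its logarithm
  i \<phi>, then \<phi>; the auxiliary germs are dropped at the end.\<close>

lemma good_germs_inverse_trig:
  assumes G: "good_germs c G" "g \<in> G" and an: "\<phi> analytic_on {c}" and T: "T \<in> trig_functions"
    and ev: "\<forall>\<^sub>F z in nhds c. T (\<phi> z) = g z"
  shows "good_germs c (insert \<phi> G)"
proof -
  let ?E = "\<lambda>z. exp (\<i> * \<phi> z)" and ?L = "\<lambda>z. \<i> * \<phi> z"
  have anE: "?E analytic_on {c}" and anL: "?L analytic_on {c}"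
    using an by (auto intro!: analytic_intros)
  have 1: "good_germs c (insert ?E G)"
  proof (rule good_germs_insert[OF G(1) anE eventually_nhds_at[OF ev]])
    fix D Y
    assume D: "dsys D Y" "G \<subseteq> Y" "?E holomorphic_on D" "\<And>z. z \<in> D \<Longrightarrow> T (\<phi> z) = g z"
    show "\<exists>D' Y'. D' \<subseteq> D \<and> Y \<subseteq> Y' \<and> dsys D' Y' \<and> ?E \<in> Y'"
      by (rule dsys_insert_exp_inverse_trig[OF D(1) subsetD[OF D(2) G(2)] T D(3,4)])
  qed
  have 2: "good_germs c (insert ?L (insert ?E G))"
    by (rule good_germs_log[OF 1 _ anL, of ?E]) auto
  have "(\<lambda>z. - \<i> * ?L z) \<in> polys (insert ?L (insert ?E G))"
    by (rule polys.mult[OF polys.const polys.gen]) simp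
  then have "good_germs c (insert \<phi> (insert ?L (insert ?E G)))"
    by (rule good_germs_polys[OF 2 _ an]) auto
  then show ?thesis by (rule good_germs_subset) auto
qed

lemma good_germs_elementary:
  assumes G: "good_germs c G" "g \<in> G" and an: "\<phi> analytic_on {c}"
    and e: "basic_elementary_germ (g c) e" and ev: "\<forall>\<^sub>F z in nhds c. \<phi> z = e (g z)"
  shows "good_germs c (insert \<phi> G)"
proof -
  have ang: "g analytic_on {c}" using good_germs_analytic[OF G] .
  note comp = eventually_compose_analytic[OF ang]
  have gG: "g \<in> polys G" using G(2) by (rule polys.gen)
  from e consider "germ_eq (g c) e exp" | "log_germ (g c) e"
    | k where "germ_eq (g c) e (\<lambda>w. w ^ (k::nat))"
    | a l where "log_germ (g c) l" "germ_eq (g c) e (\<lambda>w. exp (a * l w))"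
    | T where "T \<in> trig_functions" "germ_eq (g c) e T"
    | T where "T \<in> trig_functions" "germ_eq (g c) (\<lambda>w. T (e w)) (\<lambda>w. w)"
    unfolding basic_elementary_germ_def by blast
  then show ?thesis
  proof cases
    case 1
    show ?thesis
      by (rule good_germs_exp[OF G(1) gG an]) (use ev comp[OF 1[unfolded germ_eq_def]] in eventually_elim, simp)
  next
    case 2
    then have "\<forall>\<^sub>F w in nhds (g c). exp (e w) = w" by (auto simp: log_germ_def germ_eq_def)
    from comp[OF this] ev have "\<forall>\<^sub>F z in nhds c. exp (\<phi> z) = g z" by eventually_elim simp
    then show ?thesis by (rule good_germs_log[OF G an])
  next
    case 3
    show ?thesis
      by (rule good_germs_polys[OF G(1) polys_power[OF gG] an])
        (use ev comp[OF 3[unfolded germ_eq_def]] in eventually_elim, simp)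
  next
    case 4
    \<comment> \<open>The branch of the logarithm along \<open>g\<close> is adjoined first; the
      power is then the exponential of a multiple of it.\<close>
    let ?L = "\<lambda>z. l (g z)"
    have l: "l analytic_on {g c}" "\<forall>\<^sub>F w in nhds (g c). exp (l w) = w"
      using 4(1) by (auto simp: log_germ_def germ_eq_def)
    have "?L analytic_on {c}"
      using analytic_on_compose[OF ang, of l] l(1) by (simp add: o_def)
    then have 1: "good_germs c (insert ?L G)"
      by (rule good_germs_log[OF G _ comp[OF l(2)]])
    have "(\<lambda>z. a * ?L z) \<in> polys (insert ?L G)"
      by (intro polys_ops) (auto intro: polys.gen)
    then have "good_germs c (insert \<phi> (insert ?L G))"
      by (rule good_germs_exp[OF 1 _ an])
        (use ev comp[OF 4(2)[unfolded germ_eq_def]] in eventually_elim, simp)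
    then show ?thesis by (rule good_germs_subset) auto
  next
    case 5
    have "\<forall>\<^sub>F z in nhds c. \<phi> z = T (g z)"
      using ev comp[OF 5(2)[unfolded germ_eq_def]] by eventually_elim simp
    show ?thesis
    proof (rule good_germs_insert[OF G(1) an eventually_nhds_at[OF \<open>\<forall>\<^sub>F z in nhds c. \<phi> z = T (g z)\<close>]])
      fix D Y assume D: "dsys D Y" "G \<subseteq> Y" "\<And>z. z \<in> D \<Longrightarrow> \<phi> z = T (g z)"
      show "\<exists>D' Y'. D' \<subseteq> D \<and> Y \<subseteq> Y' \<and> dsys D' Y' \<and> \<phi> \<in> Y'"
        by (rule dsys_insert_trig[OF D(1) polys_mono[OF gG D(2)] 5(1) D(3)])
    qed
  next
    case 6
    have "\<forall>\<^sub>F z in nhds c. T (\<phi> z) = g z"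
      using ev comp[OF 6(2)[unfolded germ_eq_def]] by eventually_elim simp
    then show ?thesis by (rule good_germs_inverse_trig[OF G an 6(1)])
  qed
qed

lemma good_germs_admissible_step:
  assumes G: "good_germs c G" and adm: "admissible_step c G \<phi>"
  shows "good_germs c (insert \<phi> G)"
proof -
  have an: "\<phi> analytic_on {c}" using adm by (simp add: admissible_step_def)
  note poly = good_germs_polys[OF G _ an]
  from adm consider a where "germ_eq c \<phi> (\<lambda>z. a)" | "germ_eq c \<phi> (\<lambda>z. z)"
    | g h where "g \<in> G" "h \<in> G" "germ_eq c \<phi> (\<lambda>z. g z + h z)"
    | g h where "g \<in> G" "h \<in> G" "germ_eq c \<phi> (\<lambda>z. g z - h z)"
    | g h where "g \<in> G" "h \<in> G" "germ_eq c \<phi> (\<lambda>z. g z * h z)"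
    | g h where "g \<in> G" "h \<in> G" "\<forall>\<^sub>F z in at c. \<phi> z = g z / h z"
    | d a where "\<forall>k\<le>(d::nat). a k \<in> G" "\<exists>k\<le>d. \<not> germ_eq c (a k) (\<lambda>z. 0)"
        "germ_eq c (\<lambda>z. \<Sum>k\<le>d. a k z * \<phi> z ^ k) (\<lambda>z. 0)"
    | g where "g \<in> G" "\<forall>\<^sub>F z in nhds c. (\<phi> has_field_derivative g z) (at z)"
    | g e where "g \<in> G" "basic_elementary_germ (g c) e" "germ_eq c \<phi> (\<lambda>z. e (g z))"
    unfolding admissible_step_def by blast
  then show ?thesis
  proof cases
    case 1
    then show ?thesis by (intro poly[OF polys.const[of a]]) (auto simp: germ_eq_def)
  next
    case 2
    show ?thesis
    proof (rule good_germs_insert[OF G an eventually_nhds_at[OF 2[unfolded germ_eq_def]]])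
      fix D Y assume D: "dsys D Y" "\<phi> holomorphic_on D" "\<And>z. z \<in> D \<Longrightarrow> \<phi> z = z"
      have "deriv \<phi> z = 1" if "z \<in> D" for z
        using holomorphic_deriv_eq[OF dsysD(1)[OF D(1)] that D(3)] by simp
      then have "dsys D (insert \<phi> Y)"
        by (rule dsys_insert[OF D(1,2) polys.const[of 1]])
      then show "\<exists>D' Y'. D' \<subseteq> D \<and> Y \<subseteq> Y' \<and> dsys D' Y' \<and> \<phi> \<in> Y'"
        by (rule extend_insert)
    qed
  next
    case 3
    then show ?thesis by (intro poly[of "\<lambda>z. g z + h z"] polys_ops polys.gen) (auto simp: germ_eq_def)
  next
    case 4
    then show ?thesis by (intro poly[of "\<lambda>z. g z - h z"] polys_ops polys.gen) (auto simp: germ_eq_def)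
  next
    case 5
    then show ?thesis by (intro poly[of "\<lambda>z. g z * h z"] polys_ops polys.gen) (auto simp: germ_eq_def)
  next
    case 6
    show ?thesis
    proof (rule good_germs_insert[OF G an 6(3)])
      fix D Y assume D: "dsys D Y" "G \<subseteq> Y" "\<And>z. z \<in> D \<Longrightarrow> \<phi> z = g z / h z"
      have gh: "g \<in> polys Y" "h \<in> polys Y" using 6(1,2) D(2) by (auto intro: polys.gen)
      show "\<exists>D' Y'. D' \<subseteq> D \<and> Y \<subseteq> Y' \<and> dsys D' Y' \<and> \<phi> \<in> Y'"
        by (rule dsys_insert_quotient[OF D(1) gh D(3)])
    qed
  next
    case 7
    show ?thesis
    proof (rule good_germs_insert[OF G an eventually_nhds_at[OF 7(3)[unfolded germ_eq_def]]])
      fix D Y assume D: "dsys D Y" "G \<subseteq> Y" "\<phi> holomorphic_on D"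
        "\<And>z. z \<in> D \<Longrightarrow> (\<Sum>k\<le>d. a k z * \<phi> z ^ k) = 0"
        "\<And>g. g \<in> G \<Longrightarrow> \<not> germ_eq c g (\<lambda>z. 0) \<Longrightarrow> \<exists>z\<in>D. g z \<noteq> 0"
      show "\<exists>D' Y'. D' \<subseteq> D \<and> Y \<subseteq> Y' \<and> dsys D' Y' \<and> \<phi> \<in> Y'"
      proof (rule dsys_insert_algebraic[OF D(1,3) _ _ D(4)])
        show "a k \<in> polys Y" if "k \<le> d" for k using 7(1) D(2) that by (auto intro: polys.gen)
        show "\<exists>k\<le>d. \<exists>z\<in>D. a k z \<noteq> 0" using 7(1,2) D(5) by meson
      qed
    qed
  next
    case 8
    show ?thesis
    proof (rule good_germs_insert[OF G an eventually_nhds_at[OF 8(2)]])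
      fix D Y
      assume D: "dsys D Y" "G \<subseteq> Y" "\<And>z. z \<in> D \<Longrightarrow> (\<phi> has_field_derivative g z) (at z)"
      have "g \<in> polys Y" using 8(1) D(2) by (auto intro: polys.gen)
      from extend_insert[OF dsys_insert_antideriv[OF D(1) this D(3)]]
      show "\<exists>D' Y'. D' \<subseteq> D \<and> Y \<subseteq> Y' \<and> dsys D' Y' \<and> \<phi> \<in> Y'" .
    qed
  next
    case 9
    then show ?thesis by (intro good_germs_elementary[OF G 9(1) an 9(2)]) (auto simp: germ_eq_def)
  qed
qed

text \<open>\<open>D\<close> need not contain \<open>c\<close>, so \<open>R\<close> transports to
  \<open>D\<close> a relation known near \<open>c\<close>; for an inverse germ this is f(w(z)) =
  z.\<close>

lemma representable_germ_dsys:
  assumes "representable_germ c \<phi>" and ev: "\<forall>\<^sub>F z in nhds c. R z"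
  obtains D Y where "dsys D Y" "\<phi> \<in> Y" "\<And>z. z \<in> D \<Longrightarrow> R z"
proof -
  obtain \<phi>s where \<phi>s: "\<phi>s \<noteq> []" "germ_eq c (last \<phi>s) \<phi>"
    "\<And>i. i < length \<phi>s \<Longrightarrow> admissible_step c (set (take i \<phi>s)) (\<phi>s ! i)"
    using assms(1) by (auto simp: representable_germ_def)
  have "good_germs c (set (take i \<phi>s))" if "i \<le> length \<phi>s" for i
    using that
  proof (induction i)
    case (Suc i)
    then show ?case
      using good_germs_admissible_step[OF _ \<phi>s(3)[of i]] by (simp add: take_Suc_conv_app_nth)
  qed (simp add: good_germs_empty)
  from this[of "length \<phi>s"] have "good_germs c (set \<phi>s)" by simp
  then obtain r where r: "r > 0"
    "\<And>N. open N \<Longrightarrow> N \<noteq> {} \<Longrightarrow> N \<subseteq> ball c r \<Longrightarrow> \<exists>D Y. D \<subseteq> N \<and> dsys D Y \<and> set \<phi>s \<subseteq> Y"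
    unfolding good_germs_def by auto
  have "\<forall>\<^sub>F z in nhds c. z \<in> ball c r"
    using r(1) by (intro eventually_nhds_in_open) auto
  with ev \<phi>s(2)[unfolded germ_eq_def]
  have "\<forall>\<^sub>F z in nhds c. R z \<and> \<phi> z = last \<phi>s z \<and> z \<in> ball c r"
    by eventually_elim auto
  then obtain N where N: "open N" "c \<in> N" "\<And>z. z \<in> N \<Longrightarrow> R z \<and> \<phi> z = last \<phi>s z \<and> z \<in> ball c r"
    by (auto simp: eventually_nhds)
  obtain D Y where D: "D \<subseteq> N" "dsys D Y" "set \<phi>s \<subseteq> Y"
    using r(2)[of N] N by blast
  have "last \<phi>s \<in> polys Y" using D(3) \<phi>s(1) last_in_set by (blast intro: polys.gen)
  then have "dsys D (insert \<phi> Y)"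
    by (rule dsys_insert_polys[OF D(2)]) (use N(3) D(1) in auto)
  then show ?thesis using that[of D "insert \<phi> Y"] D N by auto
qed

section \<open>Differentially algebraic functions\<close>

lemma polys_compose: "p \<in> polys Y \<Longrightarrow> (\<lambda>z. p (f z)) \<in> polys ((\<lambda>y z. y (f z)) ` Y)"
proof (induction rule: polys.induct)
  case (gen y)
  then show ?case by (intro polys.gen) blast
qed (rule polys.intros; assumption?)+

text \<open>On w(D) the function \<open>f\<close> inverts \<open>w\<close>, so f' = 1 / (w' o f).
  Hence (y o f)' = (y' o f) f' is again polynomial in the generators composed with
  \<open>f\<close>.\<close>

lemma representable_inverse_dsys:
  assumes f: "f holomorphic_on UNIV" and rep: "representable_germ c w"
    and inv: "\<forall>\<^sub>F z in nhds c. f (w z) = z"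
  obtains D Y where "dsys D Y" "f \<in> Y"
proof -
  obtain D Y where D: "dsys D Y" "w \<in> Y" "\<And>z. z \<in> D \<Longrightarrow> f (w z) = z"
    using representable_germ_dsys[OF rep inv] by blast
  have op: "open D" using dsysD(1)[OF D(1)] .
  have hw: "w holomorphic_on D" using dsysD(5)[OF D(1,2)] .
  obtain q where q: "q \<in> polys Y" "\<And>z. z \<in> D \<Longrightarrow> deriv w z = q z"
    using dsysD(6)[OF D(1,2)] by blast
  have fq: "deriv f (w z) * q z = 1" if z: "z \<in> D" for z
  proof -
    have "(f has_field_derivative deriv f (w z)) (at (w z))"
      using f by (auto intro: holomorphic_derivI)
    moreover have "(w has_field_derivative q z) (at z)"
      using holomorphic_derivI[OF hw op z] q(2)[OF z] by simp
    ultimately have "((\<lambda>z. f (w z)) has_field_derivative deriv f (w z) * q z) (at z)"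
      by (rule DERIV_chain2)
    then have "deriv (\<lambda>z. f (w z)) z = deriv f (w z) * q z" by (rule DERIV_imp_deriv)
    moreover have "deriv (\<lambda>z. f (w z)) z = deriv (\<lambda>z. z) z"
      using holomorphic_deriv_eq[OF op z D(3)] .
    ultimately show ?thesis by simp
  qed
  then have q0: "q z \<noteq> 0" if "z \<in> D" for z using that by force
  \<comment> \<open>After composition with \<open>f\<close> the identity becomes \<open>f\<close>,
    and 1/q becomes its derivative.\<close>
  define Y1 where "Y1 = insert (\<lambda>z. z) (insert (\<lambda>z. 1 / q z) Y)"
  have Y1: "dsys D Y1"
    unfolding Y1_def
    by (rule dsys_insert[OF dsys_insert_inverse[OF D(1) q(1) q0] _ polys.const[of 1]]) auto
  define V where "V = w ` D"
  have inj: "inj_on w D" using D(3) by (metis inj_onI)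
  have V: "open V" "connected V" "V \<noteq> {}"
    using open_mapping_thm3[OF hw op inj] dsysD(3)[OF D(1)]
      connected_continuous_image[OF holomorphic_on_imp_continuous_on[OF hw] dsysD(2)[OF D(1)]]
    by (simp_all add: V_def)
  have fV: "f x \<in> D" if "x \<in> V" for x using that D(3) by (auto simp: V_def)
  have df: "deriv f x = 1 / q (f x)" if x: "x \<in> V" for x
  proof -
    obtain z where z: "z \<in> D" "x = w z" using x by (auto simp: V_def)
    then show ?thesis using fq[OF z(1)] q0[OF z(1)] D(3)[OF z(1)] by (simp add: field_simps)
  qed
  define Z where "Z = (\<lambda>y z. y (f z)) ` Y1"
  have uZ: "(\<lambda>z. 1 / q (f z)) \<in> polys Z"
    by (rule polys.gen) (auto simp: Z_def Y1_def)
  have "dsys V Z"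
    unfolding dsys_def
  proof (intro conjI V ballI)
    show "finite Z" using dsysD(4)[OF Y1] by (auto simp: Z_def)
    fix h assume "h \<in> Z"
    then obtain y where y: "y \<in> Y1" "h = (\<lambda>z. y (f z))" by (auto simp: Z_def)
    have hy: "y holomorphic_on D" using dsysD(5)[OF Y1 y(1)] .
    have fh: "f holomorphic_on V" using f holomorphic_on_subset by blast
    show "h holomorphic_on V"
      unfolding y(2) using holomorphic_on_compose_gen[OF fh hy] fV by (auto simp: o_def)
    obtain p where p: "p \<in> polys Y1" "\<And>z. z \<in> D \<Longrightarrow> deriv y z = p z"
      using dsysD(6)[OF Y1 y(1)] by blast
    have "deriv h x = p (f x) * (1 / q (f x))" if x: "x \<in> V" for x
    proof -
      have "(y has_field_derivative p (f x)) (at (f x))"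
        using holomorphic_derivI[OF hy op fV[OF x]] p(2)[OF fV[OF x]] by simp
      moreover have "(f has_field_derivative 1 / q (f x)) (at x)"
        using holomorphic_derivI[OF fh V(1) x] df[OF x] by simp
      ultimately have "(h has_field_derivative p (f x) * (1 / q (f x))) (at x)"
        unfolding y(2) by (rule DERIV_chain2)
      then show ?thesis by (rule DERIV_imp_deriv)
    qed
    moreover have "(\<lambda>x. p (f x) * (1 / q (f x))) \<in> polys Z"
      using polys.mult[OF polys_compose[OF p(1), of f, folded Z_def] uZ] .
    ultimately show "\<exists>q\<in>polys Z. \<forall>z\<in>V. deriv h z = q z" by (intro bexI) auto
  qed
  moreover have "f \<in> Z" by (auto simp: Z_def Y1_def)
  ultimately show ?thesis by (rule that)
qed

section \<open>Algebraic dependence by counting monomials\<close>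

lemma nontrivial_solution:
  fixes a :: "'i \<Rightarrow> 'j \<Rightarrow> complex"
  assumes "finite J" "finite I" "card J < card I"
  shows "\<exists>c. (\<exists>i\<in>I. c i \<noteq> 0) \<and> (\<forall>j\<in>J. (\<Sum>i\<in>I. c i * a i j) = 0)"
  using assms
proof (induction J arbitrary: I a rule: finite_induct)
  case empty
  then have "I \<noteq> {}" by auto
  then show ?case by (intro exI[of _ "\<lambda>i. 1"]) auto
next
  case (insert j J)
  show ?case
  proof (cases "\<forall>i\<in>I. a i j = 0")
    case True
    have "card J < card I" using insert by simp
    then obtain c where "\<exists>i\<in>I. c i \<noteq> 0" "\<forall>j\<in>J. (\<Sum>i\<in>I. c i * a i j) = 0"
      using insert.IH[OF insert.prems(1), of a] by blast
    then show ?thesis using True by (intro exI[of _ c]) auto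
  next
    case False
    then obtain i0 where i0: "i0 \<in> I" "a i0 j \<noteq> 0" by blast
    define I' where "I' = I - {i0}"
    have I': "finite I'" "i0 \<notin> I'" "I = insert i0 I'" using i0 insert.prems by (auto simp: I'_def)
    have "card J < card I'" using insert I' by simp
    then obtain c where c: "\<exists>i\<in>I'. c i \<noteq> 0"
      "\<forall>k\<in>J. (\<Sum>i\<in>I'. c i * (a i k - a i j / a i0 j * a i0 k)) = 0"
      using insert.IH[OF I'(1), of "\<lambda>i k. a i k - a i j / a i0 j * a i0 k"] by blast
    \<comment> \<open>The pivot unknown \<open>i0\<close> is chosen so that equation
      \<open>j\<close> holds; the other equations were already reduced by it.\<close>
    define c' where "c' = c(i0 := - (\<Sum>i\<in>I'. c i * a i j) / a i0 j)"
    have s: "(\<Sum>i\<in>I. c' i * a i k) = (\<Sum>i\<in>I'. c i * a i k) - (\<Sum>i\<in>I'. c i * a i j) / a i0 j * a i0 k" for k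
    proof -
      have "(\<Sum>i\<in>I'. c' i * a i k) = (\<Sum>i\<in>I'. c i * a i k)"
        using I'(2) by (intro sum.cong) (auto simp: c'_def)
      then show ?thesis using I' by (simp add: c'_def)
    qed
    have "(\<Sum>i\<in>I. c' i * a i k) = 0" if "k \<in> insert j J" for k
    proof (cases "k = j")
      case True
      then show ?thesis using i0(2) by (simp add: s)
    next
      case False
      then have "k \<in> J" using that by simp
      then have "(\<Sum>i\<in>I'. c i * (a i k - a i j / a i0 j * a i0 k)) = 0" using c(2) by blast
      then show ?thesis
        by (simp add: s algebra_simps sum_subtractf sum_distrib_left sum_divide_distrib)
    qed
    moreover have "\<exists>i\<in>I. c' i \<noteq> 0" using c(1) I' by (auto simp: c'_def)
    ultimately show ?thesis by blast
  qed
qed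

text \<open>Exponent vectors are extensional, so that they are determined by their values on
  \<open>Y\<close> and can be counted.\<close>

definition exps :: "'a set \<Rightarrow> nat \<Rightarrow> ('a \<Rightarrow> nat) set" where
  "exps Y e = Y \<rightarrow>\<^sub>E {..e}"

text \<open>The degree is bounded in each generator separately; this makes the number of exponent
  vectors a pure power.\<close>

definition bounded_polys :: "(complex \<Rightarrow> complex) set \<Rightarrow> nat \<Rightarrow> (complex \<Rightarrow> complex) set" where
  "bounded_polys Y e = {p. \<exists>a. p = (\<lambda>z. \<Sum>\<alpha>\<in>exps Y e. a \<alpha> * (\<Prod>y\<in>Y. y z ^ \<alpha> y))}"

lemma finite_exps: "finite Y \<Longrightarrow> finite (exps Y e)"
  by (simp add: exps_def finite_PiE)

lemma card_exps: "finite Y \<Longrightarrow> card (exps Y e) = Suc e ^ card Y"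
  by (simp add: exps_def card_PiE)

lemma exps_mono: "e \<le> e' \<Longrightarrow> exps Y e \<subseteq> exps Y e'"
  unfolding exps_def by (intro PiE_mono) auto

lemma bounded_polys_add:
  assumes "p \<in> bounded_polys Y e" "q \<in> bounded_polys Y e"
  shows "(\<lambda>z. p z + q z) \<in> bounded_polys Y e"
proof -
  obtain a b where "p = (\<lambda>z. \<Sum>\<alpha>\<in>exps Y e. a \<alpha> * (\<Prod>y\<in>Y. y z ^ \<alpha> y))"
    "q = (\<lambda>z. \<Sum>\<alpha>\<in>exps Y e. b \<alpha> * (\<Prod>y\<in>Y. y z ^ \<alpha> y))"
    using assms by (auto simp: bounded_polys_def)
  then show ?thesis
    unfolding bounded_polys_def
    by (auto intro!: exI[of _ "\<lambda>\<alpha>. a \<alpha> + b \<alpha>"] simp: distrib_right sum.distrib)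
qed

lemma bounded_polys_cmult:
  assumes "p \<in> bounded_polys Y e"
  shows "(\<lambda>z. c * p z) \<in> bounded_polys Y e"
proof -
  obtain a where "p = (\<lambda>z. \<Sum>\<alpha>\<in>exps Y e. a \<alpha> * (\<Prod>y\<in>Y. y z ^ \<alpha> y))"
    using assms by (auto simp: bounded_polys_def)
  then show ?thesis
    unfolding bounded_polys_def
    by (auto intro!: exI[of _ "\<lambda>\<alpha>. c * a \<alpha>"] simp: sum_distrib_left mult.assoc)
qed

lemma bounded_polys_sum:
  "(\<And>i. i \<in> I \<Longrightarrow> p i \<in> bounded_polys Y e) \<Longrightarrow> (\<lambda>z. \<Sum>i\<in>I. p i z) \<in> bounded_polys Y e"
proof (induction I rule: infinite_finite_induct)
  case (insert x F)
  then show ?case using bounded_polys_add[of "p x" Y e "\<lambda>z. \<Sum>i\<in>F. p i z"] by auto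
qed (auto simp: bounded_polys_def intro!: exI[of _ "\<lambda>\<alpha>. 0"])

lemma bounded_polys_mono:
  assumes "finite Y" "p \<in> bounded_polys Y e" "e \<le> e'"
  shows "p \<in> bounded_polys Y e'"
proof -
  obtain a where a: "p = (\<lambda>z. \<Sum>\<alpha>\<in>exps Y e. a \<alpha> * (\<Prod>y\<in>Y. y z ^ \<alpha> y))"
    using assms by (auto simp: bounded_polys_def)
  have "p = (\<lambda>z. \<Sum>\<alpha>\<in>exps Y e'. (if \<alpha> \<in> exps Y e then a \<alpha> else 0) * (\<Prod>y\<in>Y. y z ^ \<alpha> y))"
    unfolding a using exps_mono[OF assms(3)] finite_exps[OF assms(1)]
    by (intro ext sum.mono_neutral_cong_left) auto
  then show ?thesis
    unfolding bounded_polys_def mem_Collect_eq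
    by (rule exI[of _ "\<lambda>\<alpha>. if \<alpha> \<in> exps Y e then a \<alpha> else 0"])
qed

lemma bounded_polys_monomial:
  assumes "finite Y" "\<And>y. y \<in> Y \<Longrightarrow> \<alpha> y \<le> e"
  shows "(\<lambda>z. \<Prod>y\<in>Y. y z ^ \<alpha> y) \<in> bounded_polys Y e"
proof -
  let ?b = "restrict \<alpha> Y"
  have b: "?b \<in> exps Y e" using assms by (auto simp: exps_def)
  have "(\<Prod>y\<in>Y. y z ^ \<alpha> y) =
      (\<Sum>\<beta>\<in>exps Y e. (if \<beta> = ?b then 1 else 0) * (\<Prod>y\<in>Y. y z ^ \<beta> y))" for z
  proof -
    have "(\<Sum>\<beta>\<in>exps Y e. (if \<beta> = ?b then 1 else 0) * (\<Prod>y\<in>Y. y z ^ \<beta> y)) =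
        (\<Sum>\<beta>\<in>exps Y e. if \<beta> = ?b then (\<Prod>y\<in>Y. y z ^ ?b y) else 0)"
      by (intro sum.cong) auto
    also have "\<dots> = (\<Prod>y\<in>Y. y z ^ ?b y)"
      using b finite_exps[OF assms(1)] by (subst sum.delta) auto
    finally show ?thesis by simp
  qed
  then show ?thesis
    unfolding bounded_polys_def mem_Collect_eq by (intro exI ext)
qed

lemma bounded_polys_mult:
  assumes Y: "finite Y" and "p \<in> bounded_polys Y e" "q \<in> bounded_polys Y e'"
  shows "(\<lambda>z. p z * q z) \<in> bounded_polys Y (e + e')"
proof -
  obtain a b where ab: "p = (\<lambda>z. \<Sum>\<alpha>\<in>exps Y e. a \<alpha> * (\<Prod>y\<in>Y. y z ^ \<alpha> y))"
    "q = (\<lambda>z. \<Sum>\<alpha>\<in>exps Y e'. b \<alpha> * (\<Prod>y\<in>Y. y z ^ \<alpha> y))"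
    using assms by (auto simp: bounded_polys_def)
  have eq: "(\<lambda>z. p z * q z) =
      (\<lambda>z. \<Sum>\<alpha>\<in>exps Y e. \<Sum>\<beta>\<in>exps Y e'. (a \<alpha> * b \<beta>) * (\<Prod>y\<in>Y. y z ^ (\<alpha> y + \<beta> y)))"
    unfolding ab by (simp add: sum_product power_add prod.distrib mult_ac)
  show ?thesis
    unfolding eq
  proof (rule bounded_polys_sum)
    fix \<alpha> assume \<alpha>: "\<alpha> \<in> exps Y e"
    show "(\<lambda>z. \<Sum>\<beta>\<in>exps Y e'. (a \<alpha> * b \<beta>) * (\<Prod>y\<in>Y. y z ^ (\<alpha> y + \<beta> y))) \<in> bounded_polys Y (e + e')"
    proof (rule bounded_polys_sum)
      fix \<beta> assume \<beta>: "\<beta> \<in> exps Y e'"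
      have "\<alpha> y + \<beta> y \<le> e + e'" if "y \<in> Y" for y
        using \<alpha> \<beta> that unfolding exps_def by (intro add_mono) (auto simp: PiE_iff)
      then have "(\<lambda>z. \<Prod>y\<in>Y. y z ^ (\<alpha> y + \<beta> y)) \<in> bounded_polys Y (e + e')"
        by (rule bounded_polys_monomial[OF Y, where \<alpha> = "\<lambda>y. \<alpha> y + \<beta> y"])
      then show "(\<lambda>z. (a \<alpha> * b \<beta>) * (\<Prod>y\<in>Y. y z ^ (\<alpha> y + \<beta> y))) \<in> bounded_polys Y (e + e')"
        by (rule bounded_polys_cmult)
    qed
  qed
qed

lemma bounded_polys_const: "finite Y \<Longrightarrow> (\<lambda>z. c) \<in> bounded_polys Y e"
  using bounded_polys_cmult[where p = "\<lambda>z. \<Prod>y\<in>Y. y z ^ 0" and Y = Y and e = e and c = c]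
    bounded_polys_monomial[where \<alpha> = "\<lambda>y. 0" and Y = Y and e = e] by simp

lemma polys_imp_bounded_polys:
  assumes "p \<in> polys Y" "finite Y"
  shows "\<exists>e. p \<in> bounded_polys Y e"
  using assms(1)
proof (induction rule: polys.induct)
  case (const a)
  then show ?case using bounded_polys_const[OF assms(2)] by blast
next
  case (gen y)
  have "(\<lambda>z. \<Prod>x\<in>Y. x z ^ (if x = y then 1 else 0)) \<in> bounded_polys Y 1"
    by (rule bounded_polys_monomial[OF assms(2)]) auto
  moreover have "(\<Prod>x\<in>Y. x z ^ (if x = y then 1 else 0)) = y z" for z
  proof -
    have "(\<Prod>x\<in>Y. x z ^ (if x = y then 1 else 0)) = (\<Prod>x\<in>Y. if x = y then y z else 1)"
      by (intro prod.cong) auto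
    then show ?thesis using gen assms(2) by simp
  qed
  ultimately show ?case by auto
next
  case (add p q)
  then obtain e1 e2 where "p \<in> bounded_polys Y e1" "q \<in> bounded_polys Y e2" by blast
  then have "p \<in> bounded_polys Y (max e1 e2)" "q \<in> bounded_polys Y (max e1 e2)"
    using bounded_polys_mono[OF assms(2)] by (meson max.cobounded1 max.cobounded2)+
  then show ?case using bounded_polys_add by blast
next
  case (mult p q)
  then show ?case using bounded_polys_mult[OF assms(2)] by blast
qed

lemma bounded_polys_prod_mset:
  assumes "finite Y" "\<And>j. j \<in># M \<Longrightarrow> Q j \<in> bounded_polys Y e"
  shows "(\<lambda>z. \<Prod>j\<in>#M. Q j z) \<in> bounded_polys Y (size M * e)"
  using assms(2)
proof (induction M)
  case empty
  then show ?case using bounded_polys_const[OF assms(1)] by simp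
next
  case (add x M)
  then show ?case
    using bounded_polys_mult[OF assms(1), of "Q x" e "\<lambda>z. \<Prod>j\<in>#M. Q j z" "size M * e"] by auto
qed

text \<open>The multiset lists the orders of differentiation with multiplicity, so multisets
  correspond exactly to formal monomials in f, f', f'', ....\<close>

definition diff_monomial :: "nat multiset \<Rightarrow> (complex \<Rightarrow> complex) \<Rightarrow> complex \<Rightarrow> complex" where
  "diff_monomial M f z = (\<Prod>j\<in>#M. (deriv ^^ j) f z)"

definition lin_dep :: "(complex \<Rightarrow> complex) list \<Rightarrow> bool" where
  "lin_dep hs \<longleftrightarrow> (\<exists>c. (\<exists>i<length hs. c i \<noteq> 0) \<and> (\<forall>z. (\<Sum>i<length hs. c i * (hs ! i) z) = 0))"

text \<open>The formal monomials have to be distinct, not the functions they yield at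
  \<open>f\<close>: two monomials with the same value at \<open>f\<close> are a relation.\<close>

definition diff_algebraic :: "(complex \<Rightarrow> complex) \<Rightarrow> bool" where
  "diff_algebraic f \<longleftrightarrow> (\<exists>Ms. distinct Ms \<and> lin_dep (map (\<lambda>M. diff_monomial M f) Ms))"

lemma sum_nth_distinct:
  "distinct xs \<Longrightarrow> (\<Sum>i<length xs. F (xs ! i)) = (\<Sum>x\<in>set xs. F x)"
  by (rule sum.reindex_bij_betw) (rule bij_betw_nth; simp)

lemma diff_algebraicI:
  assumes "finite I" "\<exists>M\<in>I. c M \<noteq> 0" "\<And>z. (\<Sum>M\<in>I. c M * diff_monomial M f z) = 0"
  shows "diff_algebraic f"
proof -
  obtain Ms where Ms: "set Ms = I" "distinct Ms" using finite_distinct_list[OF assms(1)] by blast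
  have "lin_dep (map (\<lambda>M. diff_monomial M f) Ms)"
    unfolding lin_dep_def
  proof (intro exI[of _ "\<lambda>i. c (Ms ! i)"] conjI allI)
    show "\<exists>i<length (map (\<lambda>M. diff_monomial M f) Ms). c (Ms ! i) \<noteq> 0"
      using assms(2) Ms(1) by (auto simp: in_set_conv_nth)
    show "(\<Sum>i<length (map (\<lambda>M. diff_monomial M f) Ms). c (Ms ! i) * (map (\<lambda>M. diff_monomial M f) Ms ! i) z) = 0" for z
      using sum_nth_distinct[OF Ms(2), of "\<lambda>M. c M * diff_monomial M f z"] assms(3)[of z] Ms(1) by simp
  qed
  then show ?thesis using Ms(2) by (auto simp: diff_algebraic_def)
qed

lemma diff_monomial_holomorphic: "f holomorphic_on UNIV \<Longrightarrow> diff_monomial M f holomorphic_on UNIV"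
  unfolding diff_monomial_def[abs_def]
  by (induction M) (auto intro!: holomorphic_intros)

lemma dsys_higher_deriv:
  assumes "dsys D Y" "f \<in> Y"
  shows "\<exists>q\<in>polys Y. \<forall>z\<in>D. (deriv ^^ j) f z = q z"
proof (induction j)
  case 0
  then show ?case using assms(2) polys.gen by fastforce
next
  case (Suc j)
  then obtain q where q: "q \<in> polys Y" "\<And>z. z \<in> D \<Longrightarrow> (deriv ^^ j) f z = q z" by blast
  obtain p where p: "p \<in> polys Y" "\<forall>z\<in>D. deriv q z = p z" using dsys_polys_deriv[OF assms(1) q(1)] by blast
  have "(deriv ^^ Suc j) f z = p z" if "z \<in> D" for z
    using holomorphic_deriv_eq[OF dsysD(1)[OF assms(1)] that q(2)] p(2) that by simp
  then show ?case using p(1) by blast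
qed

text \<open>A dimension count: there are (d+1)^(r+1) monomials in f, ..., f^(r) with exponents at
  most d. Written in the \<open>r\<close> generators, they lie in the span of (E+1)^r monomials,
  where \<open>E\<close> is only linear in \<open>d\<close>.\<close>

lemma dsys_imp_diff_algebraic:
  assumes sys: "dsys D Y" "f \<in> Y" and hol: "f holomorphic_on UNIV"
  shows "diff_algebraic f"
proof -
  have Y: "finite Y" using dsysD(4)[OF sys(1)] .
  define r where "r = card Y"
  have "\<exists>Q. \<forall>j. Q j \<in> polys Y \<and> (\<forall>z\<in>D. (deriv ^^ j) f z = Q j z)"
    using dsys_higher_deriv[OF sys] by metis
  then obtain Q where Q: "\<And>j. Q j \<in> polys Y" "\<And>j z. z \<in> D \<Longrightarrow> (deriv ^^ j) f z = Q j z" by blast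
  obtain ej where ej: "\<And>j. Q j \<in> bounded_polys Y (ej j)"
    using polys_imp_bounded_polys[OF Q(1) Y] by metis
  define e where "e = Max (ej ` {..r})"
  have Qe: "Q j \<in> bounded_polys Y e" if "j \<le> r" for j
    using that by (intro bounded_polys_mono[OF Y ej]) (auto simp: e_def)
  \<comment> \<open>Since E + 1 \<le> ((r+1) e + 1) (d+1), this value of \<open>d\<close> gives
    (E+1)^r \<le> d (d+1)^r < (d+1)^(r+1).\<close>
  define d where "d = Suc (Suc r * e) ^ r"
  define E where "E = Suc r * d * e"
  define ms where "ms \<alpha> = (\<Sum>j\<le>r. replicate_mset (\<alpha> j) j)" for \<alpha> :: "nat \<Rightarrow> nat"
  define I where "I = ms ` exps {..r} d"
  have count_ms: "count (ms \<alpha>) j = (if j \<le> r then \<alpha> j else 0)" for \<alpha> j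
    by (simp add: ms_def count_sum)
  have inj: "inj_on ms (exps {..r} d)"
  proof (rule inj_onI)
    fix \<alpha> \<beta> assume ab: "\<alpha> \<in> exps {..r} d" "\<beta> \<in> exps {..r} d" "ms \<alpha> = ms \<beta>"
    then have "\<alpha> j = \<beta> j" if "j \<le> r" for j using count_ms[of \<alpha> j] count_ms[of \<beta> j] that by simp
    then show "\<alpha> = \<beta>" using ab(1,2) unfolding exps_def by (intro PiE_ext) auto
  qed
  have card_I: "card I = Suc d ^ Suc r"
    unfolding I_def card_image[OF inj] by (simp add: card_exps)
  have fin_I: "finite I" by (simp add: I_def finite_exps)
  have "Suc E \<le> Suc (Suc r * e) * Suc d" by (simp add: E_def algebra_simps)
  then have "Suc E ^ r \<le> (Suc (Suc r * e) * Suc d) ^ r" by (rule power_mono) simp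
  also have "\<dots> = d * Suc d ^ r" by (simp only: d_def power_mult_distrib)
  also have "\<dots> < Suc d ^ Suc r" by simp
  finally have cards: "card (exps Y E) < card I" by (simp add: card_exps[OF Y] card_I r_def)
  have "(\<lambda>z. \<Prod>j\<in>#M. Q j z) \<in> bounded_polys Y E" if M: "M \<in> I" for M
  proof -
    obtain \<alpha> where \<alpha>: "\<alpha> \<in> exps {..r} d" "M = ms \<alpha>" using M by (auto simp: I_def)
    have "j \<le> r" if "j \<in># M" for j
      using that count_ms[of \<alpha> j] \<alpha>(2) by (auto simp: count_greater_zero_iff[symmetric] split: if_splits)
    then have prod: "(\<lambda>z. \<Prod>j\<in>#M. Q j z) \<in> bounded_polys Y (size M * e)"
      by (intro bounded_polys_prod_mset[OF Y] Qe)
    have "size M = (\<Sum>j\<le>r. \<alpha> j)" by (simp add: \<alpha>(2) ms_def size_multiset_sum)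
    moreover have "(\<Sum>j\<le>r. \<alpha> j) \<le> of_nat (card {..r}) * d"
      using \<alpha>(1) by (intro sum_bounded_above) (simp add: exps_def PiE_iff)
    ultimately have "size M \<le> Suc r * d" by simp
    then have "size M * e \<le> E" unfolding E_def by (rule mult_le_mono1)
    with prod show ?thesis by (rule bounded_polys_mono[OF Y])
  qed
  then have "\<forall>M\<in>I. \<exists>a. (\<lambda>z. \<Prod>j\<in>#M. Q j z) =
      (\<lambda>z. \<Sum>\<alpha>\<in>exps Y E. a \<alpha> * (\<Prod>y\<in>Y. y z ^ \<alpha> y))"
    unfolding bounded_polys_def mem_Collect_eq by (rule ballI)
  from bchoice[OF this] obtain a where
    a': "\<forall>M\<in>I. (\<lambda>z. \<Prod>j\<in>#M. Q j z) = (\<lambda>z. \<Sum>\<alpha>\<in>exps Y E. a M \<alpha> * (\<Prod>y\<in>Y. y z ^ \<alpha> y))" ..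
  have a: "(\<Prod>j\<in>#M. Q j z) = (\<Sum>\<alpha>\<in>exps Y E. a M \<alpha> * (\<Prod>y\<in>Y. y z ^ \<alpha> y))" if "M \<in> I" for M z
    using fun_cong[OF bspec[OF a' that], of z] .
  obtain c where c: "\<exists>M\<in>I. c M \<noteq> 0" "\<And>\<alpha>. \<alpha> \<in> exps Y E \<Longrightarrow> (\<Sum>M\<in>I. c M * a M \<alpha>) = 0"
    using nontrivial_solution[OF finite_exps[OF Y] fin_I cards, of a] by blast
  have zero: "(\<Sum>M\<in>I. c M * (\<Prod>j\<in>#M. Q j z)) = 0" for z
  proof -
    have "(\<Sum>M\<in>I. c M * (\<Prod>j\<in>#M. Q j z)) =
        (\<Sum>M\<in>I. \<Sum>\<alpha>\<in>exps Y E. c M * a M \<alpha> * (\<Prod>y\<in>Y. y z ^ \<alpha> y))"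
      by (intro sum.cong refl) (simp add: a sum_distrib_left mult.assoc)
    also have "\<dots> = (\<Sum>\<alpha>\<in>exps Y E. (\<Sum>M\<in>I. c M * a M \<alpha>) * (\<Prod>y\<in>Y. y z ^ \<alpha> y))"
      by (subst sum.swap) (simp add: sum_distrib_right)
    also have "\<dots> = 0" by (intro sum.neutral) (simp add: c(2))
    finally show ?thesis .
  qed
  \<comment> \<open>The polynomials \<open>Q j\<close> represent the derivatives only on
    \<open>D\<close>; the identity theorem extends the relation to the plane.\<close>
  have "(\<Sum>M\<in>I. c M * diff_monomial M f z) = 0" for z
  proof (rule analytic_continuation_open[of D UNIV "\<lambda>z. \<Sum>M\<in>I. c M * diff_monomial M f z" "\<lambda>z. 0"])
    show "(\<lambda>z. \<Sum>M\<in>I. c M * diff_monomial M f z) holomorphic_on UNIV"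
      using diff_monomial_holomorphic[OF hol] by (intro holomorphic_intros) auto
    fix x assume "x \<in> D"
    then show "(\<Sum>M\<in>I. c M * diff_monomial M f x) = 0"
      using zero[of x] Q(2)[of x] by (simp add: diff_monomial_def)
  qed (use dsysD[OF sys(1)] in auto)
  then show ?thesis using diff_algebraicI[OF fin_I c(1)] by blast
qed

lemma diff_transcendental_imp_not_representable:
  assumes "f holomorphic_on UNIV" "\<not> diff_algebraic f"
  shows "inverse_not_representable f"
  unfolding inverse_not_representable_def germ_eq_def
  using representable_inverse_dsys[OF assms(1)] dsys_imp_diff_algebraic assms by metis

section \<open>Topology of the spaces of entire functions\<close>

text \<open>Fraction-free Gaussian elimination: up to powers of the pivots this is the determinant of the
  matrix of values of the functions at the points.\<close>

fun elim_det :: "(complex \<Rightarrow> complex) list \<Rightarrow> complex list \<Rightarrow> complex" where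
  "elim_det [] zs = 1"
| "elim_det (h # hs) [] = 0"
| "elim_det (h # hs) (z # zs) = h z * elim_det (map (\<lambda>k x. h z * k x - k z * h x) hs) zs"

text \<open>At a pivot h(z) \<noteq> 0 the tail of the relation survives elimination: its sums at x
  and at z equal -c_0 h(x) and -c_0 h(z), and the cross terms cancel. The tail is nontrivial, as
  otherwise c_0 h(z) = 0 would force c_0 = 0.\<close>

lemma lin_dep_imp_elim_det: "lin_dep hs \<Longrightarrow> elim_det hs zs = 0"
proof (induction hs zs rule: elim_det.induct)
  case (1 zs)
  then show ?case by (simp add: lin_dep_def)
next
  case (3 h hs z zs)
  show ?case
  proof (cases "h z = 0")
    case False
    obtain c where c: "\<exists>i<length (h # hs). c i \<noteq> 0" "\<And>x. (\<Sum>i<length (h # hs). c i * ((h # hs) ! i) x) = 0"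
      using "3.prems" unfolding lin_dep_def by blast
    have s: "(\<Sum>i<length hs. c (Suc i) * (hs ! i) x) = - c 0 * h x" for x
      using c(2)[of x] unfolding list.size add_0_right add_Suc_right sum.lessThan_Suc_shift
      by (simp add: add_eq_0_iff)
    have "lin_dep (map (\<lambda>k x. h z * k x - k z * h x) hs)"
      unfolding lin_dep_def
    proof (intro exI[of _ "\<lambda>i. c (Suc i)"] conjI allI)
      fix x
      have "(\<Sum>i<length (map (\<lambda>k x. h z * k x - k z * h x) hs).
          c (Suc i) * (map (\<lambda>k x. h z * k x - k z * h x) hs ! i) x) =
        (\<Sum>i<length hs. h z * (c (Suc i) * (hs ! i) x) - h x * (c (Suc i) * (hs ! i) z))"
        by (simp add: algebra_simps)
      also have "\<dots> = h z * (\<Sum>i<length hs. c (Suc i) * (hs ! i) x) - h x * (\<Sum>i<length hs. c (Suc i) * (hs ! i) z)"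
        by (simp add: sum_subtractf sum_distrib_left)
      also have "\<dots> = 0" unfolding s by simp
      finally show "(\<Sum>i<length (map (\<lambda>k x. h z * k x - k z * h x) hs).
          c (Suc i) * (map (\<lambda>k x. h z * k x - k z * h x) hs ! i) x) = 0" .
    next
      obtain i where i: "i < Suc (length hs)" "c i \<noteq> 0" using c(1) by auto
      show "\<exists>i<length (map (\<lambda>k x. h z * k x - k z * h x) hs). c (Suc i) \<noteq> 0"
      proof (rule ccontr)
        assume "\<not> ?thesis"
        then have z: "c (Suc i) = 0" if "i < length hs" for i using that by auto
        then have "c 0 = 0" using s[of z] False by simp
        then show False using i z by (cases i) auto
      qed
    qed
    then show ?thesis using "3.IH" by simp
  qed simp
qed simp

text \<open>The first function is not identically zero, which provides a pivot point. A relation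
  among the reduced functions would lift to one among the original functions, so independence passes
  to the shorter list.\<close>

lemma not_lin_dep_imp_elim_det: "\<not> lin_dep hs \<Longrightarrow> \<exists>zs. elim_det hs zs \<noteq> 0"
proof (induction "length hs" arbitrary: hs)
  case (Suc n)
  then obtain h hs' where hs: "hs = h # hs'" by (cases hs) auto
  have "\<exists>z. h z \<noteq> 0"
  proof (rule ccontr)
    assume "\<not> ?thesis"
    then have "lin_dep hs"
      unfolding lin_dep_def hs
      by (intro exI[of _ "\<lambda>i. if i = 0 then 1 else 0"] conjI exI[of _ 0] allI sum.neutral ballI)
        (auto simp: nth_Cons')
    then show False using Suc.prems by contradiction
  qed
  then obtain z where z: "h z \<noteq> 0" by blast
  define ks where "ks = map (\<lambda>k x. h z * k x - k z * h x) hs'"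
  have "\<not> lin_dep ks"
  proof
    assume "lin_dep ks"
    then obtain c where c: "\<exists>i<length ks. c i \<noteq> 0" "\<And>x. (\<Sum>i<length ks. c i * (ks ! i) x) = 0"
      unfolding lin_dep_def by blast
    \<comment> \<open>The relation among the functions h(z) k_i - k_i(z) h, sorted by h and the
      k_i.\<close>
    define c' where "c' = case_nat (- (\<Sum>i<length hs'. c i * (hs' ! i) z)) (\<lambda>i. c i * h z)"
    have "(\<Sum>i<length hs. c' i * (hs ! i) x) = 0" for x
    proof -
      have "(\<Sum>i<length hs. c' i * (hs ! i) x) = c' 0 * h x + (\<Sum>i<length hs'. c' (Suc i) * (hs' ! i) x)"
        unfolding hs list.size add_0_right add_Suc_right sum.lessThan_Suc_shift by simp
      also have "\<dots> = (\<Sum>i<length ks. c i * (ks ! i) x)"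
        by (simp add: c'_def ks_def right_diff_distrib sum_subtractf sum_distrib_left sum_distrib_right mult_ac)
      finally show ?thesis using c(2) by simp
    qed
    moreover have "\<exists>i<length hs. c' i \<noteq> 0"
    proof -
      obtain i where "i < length hs'" "c i \<noteq> 0" using c(1) by (auto simp: ks_def)
      then show ?thesis using z by (intro exI[of _ "Suc i"]) (auto simp: c'_def hs)
    qed
    ultimately show False using Suc.prems by (auto simp: lin_dep_def)
  qed
  then obtain zs where "elim_det ks zs \<noteq> 0" using Suc.hyps(1)[of ks] Suc.hyps(2) hs by (auto simp: ks_def)
  then show ?case using z hs by (intro exI[of _ "z # zs"]) (simp add: ks_def)
qed (auto intro: exI[of _ "[]"])

text \<open>Every entry takes the parameter as its first argument, and the limit is written as the
  value at a further parameter \<open>q\<close>. Elimination then acts on the family and its limit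
  at once.\<close>

lemma elim_det_tendsto:
  assumes "\<And>h x. h \<in> set hs \<Longrightarrow> ((\<lambda>p. h p x) \<longlongrightarrow> h q x) F"
  shows "((\<lambda>p. elim_det (map (\<lambda>h. h p) hs) zs) \<longlongrightarrow> elim_det (map (\<lambda>h. h q) hs) zs) F"
  using assms
proof (induction zs arbitrary: hs)
  case Nil
  then show ?case by (cases hs) auto
next
  case (Cons z zs)
  show ?case
  proof (cases hs)
    case hs: (Cons h hs')
    define ks where "ks = map (\<lambda>k p x. h p z * k p x - k p z * h p x) hs'"
    have ks: "map (\<lambda>k x. h p z * k x - k z * h p x) (map (\<lambda>h. h p) hs') = map (\<lambda>k. k p) ks" for p
      by (simp add: ks_def)
    have "((\<lambda>p. elim_det (map (\<lambda>k. k p) ks) zs) \<longlongrightarrow> elim_det (map (\<lambda>k. k q) ks) zs) F"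
      by (rule Cons.IH) (use Cons.prems hs in \<open>auto simp: ks_def intro!: tendsto_intros\<close>)
    moreover have "((\<lambda>p. h p z) \<longlongrightarrow> h q z) F" using Cons.prems hs by auto
    ultimately have "((\<lambda>p. h p z * elim_det (map (\<lambda>k. k p) ks) zs) \<longlongrightarrow> h q z * elim_det (map (\<lambda>k. k q) ks) zs) F"
      by (intro tendsto_mult)
    then show ?thesis by (simp only: hs list.map elim_det.simps ks)
  qed simp
qed

lemma elim_det_holomorphic:
  assumes "\<And>h x. h \<in> set hs \<Longrightarrow> (\<lambda>p. h p x) holomorphic_on S"
  shows "(\<lambda>p. elim_det (map (\<lambda>h. h p) hs) zs) holomorphic_on S"
  using assms
proof (induction zs arbitrary: hs)
  case Nil
  then show ?case by (cases hs) auto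
next
  case (Cons z zs)
  show ?case
  proof (cases hs)
    case hs: (Cons h hs')
    define ks where "ks = map (\<lambda>k p x. h p z * k p x - k p z * h p x) hs'"
    have ks: "map (\<lambda>k x. h p z * k x - k z * h p x) (map (\<lambda>h. h p) hs') = map (\<lambda>k. k p) ks" for p
      by (simp add: ks_def)
    have "(\<lambda>p. elim_det (map (\<lambda>k. k p) ks) zs) holomorphic_on S"
      by (rule Cons.IH) (use Cons.prems hs in \<open>auto simp: ks_def intro!: holomorphic_intros\<close>)
    moreover have "(\<lambda>p. h p z) holomorphic_on S" using Cons.prems hs by auto
    ultimately have "(\<lambda>p. h p z * elim_det (map (\<lambda>k. k p) ks) zs) holomorphic_on S"
      by (intro holomorphic_intros)
    then show ?thesis by (simp only: hs list.map elim_det.simps ks)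
  qed simp
qed

section \<open>Growth, norms and Cauchy estimates\<close>

lemma E_space_holomorphic: "f \<in> E_space \<rho> p \<Longrightarrow> f holomorphic_on UNIV"
  by (simp add: E_space_def)

lemma E_norm_bound:
  assumes "f \<in> E_space \<rho> p" "n \<ge> 1"
  shows "cmod (f z) \<le> E_norm \<rho> p n f * exp ((p + 1 / real n) * cmod z ^ \<rho>)"
proof -
  have "exp (- (p + 1 / real n) * cmod z ^ \<rho>) * cmod (f z) \<le> E_norm \<rho> p n f"
    unfolding E_norm_def by (rule cSUP_upper[OF _ bdd_above_E_norm[OF assms]]) simp
  then have "cmod (f z) / exp ((p + 1 / real n) * cmod z ^ \<rho>) \<le> E_norm \<rho> p n f"
    unfolding mult_minus_left exp_minus by (simp add: divide_inverse mult.commute)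
  then show ?thesis by (simp add: pos_divide_le_eq)
qed

lemma E_space_growth:
  assumes "f \<in> E_space \<rho> p" "p < q"
  obtains C where "\<And>z. cmod (f z) \<le> C * exp (q * cmod z ^ \<rho>)" "C \<ge> 0"
proof -
  obtain n where "n \<noteq> 0" "inverse (real n) < q - p"
    using real_arch_inverse[of "q - p"] assms(2) by auto
  then have n: "n \<ge> 1" "1 / real n < q - p" by (simp_all add: inverse_eq_divide)
  define C where "C = \<bar>E_norm \<rho> p n f\<bar>"
  have "cmod (f z) \<le> C * exp (q * cmod z ^ \<rho>)" for z
  proof -
    have "cmod (f z) \<le> E_norm \<rho> p n f * exp ((p + 1 / real n) * cmod z ^ \<rho>)"
      by (rule E_norm_bound[OF assms(1) n(1)])
    also have "\<dots> \<le> C * exp (q * cmod z ^ \<rho>)"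
      unfolding C_def using n by (intro mult_mono) (auto intro!: mult_right_mono)
    finally show ?thesis .
  qed
  then show ?thesis using that[of C] by (simp add: C_def)
qed

text \<open>The converse of \<open>E_space_growth\<close>: membership becomes a family of bounds,
  one for each q > p, and such bounds pass to linear combinations.\<close>

lemma E_spaceI:
  assumes hol: "f holomorphic_on UNIV" and \<rho>: "\<rho> \<ge> 1"
    and bd: "\<And>q. p < q \<Longrightarrow> \<exists>C. \<forall>z. cmod (f z) \<le> C * exp (q * cmod z ^ \<rho>)"
  shows "f \<in> E_space \<rho> p"
proof -
  \<comment> \<open>\<open>S\<close> is antitone, so its limit at infinity exists and equals its
    infimum.\<close>
  define S where "S R = (SUP z\<in>{z. R \<le> cmod z}. log_growth \<rho> f z)" for R :: real
  define L where "L = (INF R. S R)"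
  have anti: "S R' \<le> S R" if "R \<le> R'" for R R'
    unfolding S_def using that by (intro SUP_subset_mono) auto
  have "(S \<longlongrightarrow> L) at_top"
  proof (rule order_tendstoI)
    fix a assume "a < L"
    moreover have "L \<le> S R" for R unfolding L_def by (rule INF_lower) simp
    ultimately have "a < S R" for R by (rule less_le_trans)
    then show "\<forall>\<^sub>F R in at_top. a < S R" by simp
  next
    fix a assume "L < a"
    then obtain R0 where "S R0 < a" unfolding L_def INF_less_iff by blast
    then have "S R < a" if "R0 \<le> R" for R using anti[OF that] by (rule le_less_trans[rotated])
    then show "\<forall>\<^sub>F R in at_top. S R < a" unfolding eventually_at_top_linorder by blast
  qed
  moreover have "L \<le> ereal p"
  proof (rule ereal_le_epsilon2)
    fix e :: real assume e: "e > 0"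
    obtain C where C: "\<And>z. cmod (f z) \<le> C * exp ((p + e / 2) * cmod z ^ \<rho>)"
      using bd[of "p + e / 2"] e by auto
    define C' where "C' = max C 1"
    have C': "C' \<ge> 1" "cmod (f z) \<le> C' * exp ((p + e / 2) * cmod z ^ \<rho>)" for z
      using order_trans[OF C[of z] mult_right_mono[of C C']] by (simp_all add: C'_def)
    \<comment> \<open>Beyond \<open>R\<close> the constant is absorbed: ln C' \<le> (e/2) |z| \<le>
      (e/2) |z|^\<rho>, the second inequality because |z| \<ge> 1.\<close>
    define R where "R = max 1 (2 * ln C' / e)"
    have "log_growth \<rho> f z \<le> ereal (p + e)" if z: "R \<le> cmod z" for z
    proof (cases "f z = 0")
      case False
      have z1: "cmod z \<ge> 1" "2 * ln C' / e \<le> cmod z" using z by (auto simp: R_def)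
      have zr: "cmod z \<le> cmod z ^ \<rho>" using z1(1) \<rho> self_le_power by force
      have "ln (cmod (f z)) \<le> ln (C' * exp ((p + e / 2) * cmod z ^ \<rho>))"
        using C'(1) C'(2)[of z] False by (subst ln_le_cancel_iff) (auto intro: mult_pos_pos)
      also have "\<dots> = ln C' + (p + e / 2) * cmod z ^ \<rho>" using C'(1) by (simp add: ln_mult)
      also have "ln C' \<le> e / 2 * cmod z" using z1(2) e by (simp add: field_simps)
      also have "e / 2 * cmod z \<le> e / 2 * cmod z ^ \<rho>" using zr e by (intro mult_left_mono) auto
      finally have "ln (cmod (f z)) \<le> (p + e) * cmod z ^ \<rho>" by (simp add: algebra_simps)
      moreover have "cmod z ^ \<rho> > 0" using z1 zr by linarith
      ultimately show ?thesis using False by (simp add: log_growth_def field_simps)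
    qed (simp add: log_growth_def)
    then have "S R \<le> ereal (p + e)" unfolding S_def by (intro SUP_least) auto
    then show "L \<le> ereal p + ereal e"
      unfolding L_def using INF_lower[of R UNIV S] order_trans by fastforce
  qed
  ultimately show ?thesis using hol unfolding E_space_def S_def by blast
qed

lemma E_space_add_cmult:
  assumes \<rho>: "\<rho> \<ge> 1" and f: "f \<in> E_space \<rho> p" and g: "g \<in> E_space \<rho> p"
  shows "(\<lambda>z. f z + t * g z) \<in> E_space \<rho> p"
proof (rule E_spaceI[OF _ \<rho>])
  show "(\<lambda>z. f z + t * g z) holomorphic_on UNIV"
    using f g by (intro holomorphic_intros E_space_holomorphic) auto
  fix q assume q: "p < q"
  obtain C where C: "\<And>z. cmod (f z) \<le> C * exp (q * cmod z ^ \<rho>)" using E_space_growth[OF f q] by blast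
  obtain D where D: "\<And>z. cmod (g z) \<le> D * exp (q * cmod z ^ \<rho>)" using E_space_growth[OF g q] by blast
  have "cmod (f z + t * g z) \<le> (C + cmod t * D) * exp (q * cmod z ^ \<rho>)" for z
  proof -
    have "cmod (f z + t * g z) \<le> cmod (f z) + cmod t * cmod (g z)"
      using norm_triangle_ineq[of "f z" "t * g z"] by (simp add: norm_mult)
    also have "\<dots> \<le> C * exp (q * cmod z ^ \<rho>) + cmod t * (D * exp (q * cmod z ^ \<rho>))"
      by (intro add_mono C mult_left_mono D) auto
    finally show ?thesis by (simp add: algebra_simps)
  qed
  then show "\<exists>C. \<forall>z. cmod (f z + t * g z) \<le> C * exp (q * cmod z ^ \<rho>)" by blast
qed

lemma E_space_diff:
  assumes "\<rho> \<ge> 1" "f \<in> E_space \<rho> p" "g \<in> E_space \<rho> p"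
  shows "(\<lambda>z. f z - g z) \<in> E_space \<rho> p"
  using E_space_add_cmult[OF assms, of "- 1"] by simp

lemma E_norm_add_cmult_le:
  assumes f: "f \<in> E_space \<rho> p" and g: "g \<in> E_space \<rho> p" and n: "n \<ge> 1"
  shows "E_norm \<rho> p n (\<lambda>z. f z + t * g z) \<le> E_norm \<rho> p n f + cmod t * E_norm \<rho> p n g"
  unfolding E_norm_def
proof (rule cSUP_least)
  fix z :: complex
  let ?w = "exp (- (p + 1 / real n) * cmod z ^ \<rho>)"
  have b: "?w * cmod (h z) \<le> (SUP z. exp (- (p + 1 / real n) * cmod z ^ \<rho>) * cmod (h z))"
    if "h \<in> E_space \<rho> p" for h
    by (rule cSUP_upper[OF _ bdd_above_E_norm[OF that n]]) simp
  have "?w * cmod (f z + t * g z) \<le> ?w * (cmod (f z) + cmod t * cmod (g z))"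
    using norm_triangle_ineq[of "f z" "t * g z"] by (intro mult_left_mono) (auto simp: norm_mult)
  also have "\<dots> = ?w * cmod (f z) + cmod t * (?w * cmod (g z))" by (simp add: algebra_simps)
  also have "\<dots> \<le> (SUP z. exp (- (p + 1 / real n) * cmod z ^ \<rho>) * cmod (f z)) +
      cmod t * (SUP z. exp (- (p + 1 / real n) * cmod z ^ \<rho>) * cmod (g z))"
    by (intro add_mono b f g mult_left_mono) auto
  finally show "?w * cmod (f z + t * g z) \<le> \<dots>" .
qed simp

text \<open>Cauchy's inequality on the unit circle around \<open>z\<close>. It makes convergence in
  the norm of index 1 imply convergence of all derivatives at every point.\<close>

lemma higher_deriv_E_norm_bound:
  assumes g: "g \<in> E_space \<rho> p" and p: "p > 0"
  shows "cmod ((deriv ^^ j) g z) \<le> fact j * (E_norm \<rho> p 1 g * exp ((p + 1) * (cmod z + 1) ^ \<rho>))"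
proof -
  have "0 \<le> E_norm \<rho> p 1 g * exp ((p + 1) * cmod 0 ^ \<rho>)"
    using E_norm_bound[OF g, of 1 0] by (simp add: order_trans[OF norm_ge_zero])
  then have nn: "0 \<le> E_norm \<rho> p 1 g" by (simp add: zero_le_mult_iff)
  have hol: "g holomorphic_on UNIV" using E_space_holomorphic[OF g] .
  have "cmod ((deriv ^^ j) g z) \<le> fact j * (E_norm \<rho> p 1 g * exp ((p + 1) * (cmod z + 1) ^ \<rho>)) / 1 ^ j"
  proof (rule Cauchy_inequality)
    show "g holomorphic_on ball z 1" using hol holomorphic_on_subset by blast
    show "continuous_on (cball z 1) g"
      using holomorphic_on_imp_continuous_on[OF hol] continuous_on_subset by blast
    fix x assume x: "cmod (z - x) = 1"
    have "cmod x \<le> cmod z + 1" using x norm_triangle_sub[of x z] by (simp add: norm_minus_commute)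
    then have "exp ((p + 1) * cmod x ^ \<rho>) \<le> exp ((p + 1) * (cmod z + 1) ^ \<rho>)"
      using p by (intro iffD2[OF exp_le_cancel_iff] mult_left_mono power_mono) auto
    then have "E_norm \<rho> p 1 g * exp ((p + 1) * cmod x ^ \<rho>) \<le> E_norm \<rho> p 1 g * exp ((p + 1) * (cmod z + 1) ^ \<rho>)"
      using nn by (rule mult_left_mono)
    then show "cmod (g x) \<le> E_norm \<rho> p 1 g * exp ((p + 1) * (cmod z + 1) ^ \<rho>)"
      using E_norm_bound[OF g, of 1 x] by simp
  qed simp
  then show ?thesis by simp
qed

lemma diff_monomial_tendsto:
  assumes "\<And>j. ((\<lambda>k. (deriv ^^ j) (h k) z) \<longlongrightarrow> (deriv ^^ j) f z) F"
  shows "((\<lambda>k. diff_monomial M (h k) z) \<longlongrightarrow> diff_monomial M f z) F"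
  unfolding diff_monomial_def by (induction M) (auto intro!: tendsto_intros assms)

section \<open>Openness of independence and the G_delta property\<close>

lemma openin_not_lin_dep:
  assumes \<rho>: "\<rho> \<ge> 1" and p: "p > 0"
  shows "openin (E_topology \<rho> p) {f \<in> E_space \<rho> p. \<not> lin_dep (map (\<lambda>M. diff_monomial M f) Ms)}"
    (is "openin _ ?U")
proof (subst openin_subopen, intro ballI)
  fix f assume "f \<in> ?U"
  then have f: "f \<in> E_space \<rho> p" "\<not> lin_dep (map (\<lambda>M. diff_monomial M f) Ms)" by auto
  let ?B = "\<lambda>e. {h \<in> E_space \<rho> p. E_norm \<rho> p 1 (\<lambda>z. h z - f z) < e}"
  \<comment> \<open>Otherwise functions \<open>h k\<close> with dependent monomials would converge
    to \<open>f\<close>, and a determinant that is nonzero at \<open>f\<close> would be the limit of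
    determinants that all vanish.\<close>
  have "\<exists>e>0. ?B e \<subseteq> ?U"
  proof (rule ccontr)
    assume *: "\<not> ?thesis"
    have "\<forall>k. \<exists>h. h \<in> ?B (1 / real (Suc k)) \<and> h \<notin> ?U"
    proof
      fix k
      have "\<not> ?B (1 / real (Suc k)) \<subseteq> ?U" using * zero_less_divide_1_iff of_nat_0_less_iff by blast
      then show "\<exists>h. h \<in> ?B (1 / real (Suc k)) \<and> h \<notin> ?U" by (simp only: subset_iff not_all not_imp)
    qed
    from choice[OF this] obtain h where h': "\<And>k. h k \<in> ?B (1 / real (Suc k))" "\<And>k. h k \<notin> ?U" by auto
    then have h: "\<And>k. h k \<in> ?B (1 / real (Suc k))" "\<And>k. lin_dep (map (\<lambda>M. diff_monomial M (h k)) Ms)"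
      by simp_all
    have lim: "(\<lambda>k. (deriv ^^ j) (h k) z) \<longlonglongrightarrow> (deriv ^^ j) f z" for j z
    proof -
      define K where "K = fact j * exp ((p + 1) * (cmod z + 1) ^ \<rho>)"
      have bound: "cmod ((deriv ^^ j) (h k) z - (deriv ^^ j) f z) \<le> K * (1 / real (Suc k))" for k
      proof -
        have hk: "h k \<in> E_space \<rho> p" "E_norm \<rho> p 1 (\<lambda>z. h k z - f z) \<le> 1 / real (Suc k)"
          using h(1)[of k] by auto
        have "(deriv ^^ j) (\<lambda>z. h k z - f z) z = (deriv ^^ j) (h k) z - (deriv ^^ j) f z"
          using E_space_holomorphic[OF hk(1)] E_space_holomorphic[OF f(1)]
          by (intro higher_deriv_diff[of _ UNIV]) auto
        then have "cmod ((deriv ^^ j) (h k) z - (deriv ^^ j) f z) \<le>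
          fact j * (E_norm \<rho> p 1 (\<lambda>z. h k z - f z) * exp ((p + 1) * (cmod z + 1) ^ \<rho>))"
          using higher_deriv_E_norm_bound[OF E_space_diff[OF \<rho> hk(1) f(1)] p, of j z] by simp
        also have "\<dots> = K * E_norm \<rho> p 1 (\<lambda>z. h k z - f z)" by (simp add: K_def)
        also have "\<dots> \<le> K * (1 / real (Suc k))"
          using hk(2) by (intro mult_left_mono) (auto simp: K_def)
        finally show ?thesis .
      qed
      have "(\<lambda>k. K * (1 / real (Suc k))) \<longlonglongrightarrow> 0"
        using tendsto_mult_right_zero[OF LIMSEQ_inverse_real_of_nat, of K] by (simp add: inverse_eq_divide)
      then have "(\<lambda>k. (deriv ^^ j) (h k) z - (deriv ^^ j) f z) \<longlonglongrightarrow> 0"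
        by (rule Lim_null_comparison[rotated]) (intro always_eventually allI bound)
      then show ?thesis by (rule LIM_zero_cancel)
    qed
    obtain zs where zs: "elim_det (map (\<lambda>M. diff_monomial M f) Ms) zs \<noteq> 0"
      using not_lin_dep_imp_elim_det[OF f(2)] by blast
    \<comment> \<open>The index \<open>None\<close> stands for the limit \<open>f\<close>, as the
      convergence lemma wants the limit to be a parameter value too.\<close>
    define hh where "hh k = (case k of None \<Rightarrow> f | Some k \<Rightarrow> h k)" for k
    have "((\<lambda>k. elim_det (map (\<lambda>m. m k) (map (\<lambda>M k. diff_monomial M (hh k)) Ms)) zs) \<longlongrightarrow>
        elim_det (map (\<lambda>m. m None) (map (\<lambda>M k. diff_monomial M (hh k)) Ms)) zs) (filtermap Some sequentially)"
    proof (rule elim_det_tendsto)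
      fix m x assume "m \<in> set (map (\<lambda>M k. diff_monomial M (hh k)) Ms)"
      then obtain M where m: "m = (\<lambda>k. diff_monomial M (hh k))" by auto
      show "((\<lambda>k. m k x) \<longlongrightarrow> m None x) (filtermap Some sequentially)"
        using diff_monomial_tendsto[of h x f sequentially M] lim
        by (simp add: m filterlim_filtermap hh_def)
    qed
    then have "(\<lambda>k. elim_det (map (\<lambda>M. diff_monomial M (h k)) Ms) zs) \<longlonglongrightarrow>
      elim_det (map (\<lambda>M. diff_monomial M f) Ms) zs"
      by (simp add: filterlim_filtermap hh_def o_def)
    then show False
      using zs lin_dep_imp_elim_det[OF h(2)] by (simp add: LIMSEQ_const_iff)
  qed
  then obtain e where e: "e > 0" "?B e \<subseteq> ?U" by blast
  have "?B e \<in> {{f \<in> E_space \<rho> p. E_norm \<rho> p n (\<lambda>z. f z - g z) < \<epsilon>} | g n \<epsilon>.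
        g \<in> E_space \<rho> p \<and> n \<ge> 1 \<and> \<epsilon> > 0}"
    using f(1) e(1) by blast
  then have "openin (E_topology \<rho> p) (?B e)"
    unfolding E_topology_def by (rule topology_generated_by_Basis)
  moreover have "f \<in> ?B e" using f(1) e(1) by (simp add: E_norm_def)
  ultimately show "\<exists>T. openin (E_topology \<rho> p) T \<and> f \<in> T \<and> T \<subseteq> ?U" using e(2) by blast
qed

lemma countable_multiset_lists: "countable (UNIV :: nat multiset list set)"
proof -
  have "Ms \<in> range (map mset)" for Ms :: "nat multiset list"
  proof (induction Ms)
    case (Cons M Ms)
    obtain xs where "M = mset xs" using ex_mset[of M] by blast
    moreover obtain xss where "Ms = map mset xss" using Cons by blast
    ultimately show ?case by (intro image_eqI[of _ _ "xs # xss"]) auto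
  qed auto
  then have "range (map mset) = (UNIV :: nat multiset list set)" by auto
  then show ?thesis by (metis countable_image countableI_type)
qed

lemma gdelta_in_diff_transcendental:
  assumes \<rho>: "\<rho> \<ge> 1" and p: "p > 0"
  shows "gdelta_in (E_topology \<rho> p) {f \<in> E_space \<rho> p. \<not> diff_algebraic f}"
proof -
  define U where "U Ms = {f \<in> E_space \<rho> p. \<not> lin_dep (map (\<lambda>M. diff_monomial M f) Ms)}"
    for Ms :: "nat multiset list"
  have "countable (U ` {Ms. distinct Ms})"
    by (meson countable_image countable_subset subset_UNIV countable_multiset_lists)
  moreover have "gdelta_in (E_topology \<rho> p) S" if "S \<in> U ` {Ms. distinct Ms}" for S
    using that openin_not_lin_dep[OF assms] by (auto simp: U_def intro!: open_imp_gdelta_in)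
  \<comment> \<open>The empty list belongs to the family and contributes the whole space, the empty
    family of functions being independent.\<close>
  moreover have "U ` {Ms. distinct Ms} \<noteq> {}" using distinct.simps(1) by blast
  ultimately have "gdelta_in (E_topology \<rho> p) (\<Inter> (U ` {Ms. distinct Ms}))"
    by (intro gdelta_in_Inter)
  moreover have "\<Inter> (U ` {Ms. distinct Ms}) = {f \<in> E_space \<rho> p. \<not> diff_algebraic f}"
    unfolding U_def diff_algebraic_def by (auto intro: distinct.simps(1))
  ultimately show ?thesis by simp
qed

section \<open>Density along complex lines\<close>

text \<open>Continuity of t |-> f + t g at t = 0. The balls only generate the topology, hence the
  induction over generated open sets.\<close>

lemma eventually_line_in_open:
  assumes \<rho>: "\<rho> \<ge> 1" and U: "openin (E_topology \<rho> p) U" and f: "f \<in> U" and g: "g \<in> E_space \<rho> p"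
  shows "\<exists>d>0. \<forall>t. cmod t < d \<longrightarrow> (\<lambda>z. f z + t * g z) \<in> U"
proof -
  have fE: "f \<in> E_space \<rho> p" using U f openin_subset topspace_E_topology by blast
  have "generate_topology_on {{f \<in> E_space \<rho> p. E_norm \<rho> p n (\<lambda>z. f z - g z) < \<epsilon>} | g n \<epsilon>.
        g \<in> E_space \<rho> p \<and> n \<ge> 1 \<and> \<epsilon> > 0} U"
    using U by (simp add: E_topology_def openin_topology_generated_by_iff)
  then show ?thesis using f
  proof (induction rule: generate_topology_on.induct)
    case (Int a b)
    then obtain d e where "d > 0" "\<forall>t. cmod t < d \<longrightarrow> (\<lambda>z. f z + t * g z) \<in> a"
      "e > 0" "\<forall>t. cmod t < e \<longrightarrow> (\<lambda>z. f z + t * g z) \<in> b" by auto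
    then show ?case by (intro exI[of _ "min d e"]) auto
  next
    case (UN K)
    then obtain k where "k \<in> K" "f \<in> k" by blast
    then show ?case using UN.IH[of k] by blast
  next
    case (Basis s)
    then obtain g0 n e where s: "s = {f \<in> E_space \<rho> p. E_norm \<rho> p n (\<lambda>z. f z - g0 z) < e}"
      "g0 \<in> E_space \<rho> p" "n \<ge> 1" "e > 0" by blast
    \<comment> \<open>\<open>N\<close> majorizes the norm of \<open>g\<close>; the summand 1 makes
      it a positive divisor. Below, \<open>r\<close> is the room left in the ball.\<close>
    define N where "N = \<bar>E_norm \<rho> p n g\<bar> + 1"
    define r where "r = e - E_norm \<rho> p n (\<lambda>z. f z - g0 z)"
    have r: "r > 0" "N > 0" using Basis.prems s by (auto simp: r_def N_def)
    have "(\<lambda>z. f z + t * g z) \<in> s" if t: "cmod t < r / N" for t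
    proof -
      have "E_norm \<rho> p n (\<lambda>z. (f z - g0 z) + t * g z) \<le> E_norm \<rho> p n (\<lambda>z. f z - g0 z) + cmod t * E_norm \<rho> p n g"
        by (rule E_norm_add_cmult_le[OF E_space_diff[OF \<rho> fE s(2)] g s(3)])
      also have "cmod t * E_norm \<rho> p n g \<le> cmod t * N" by (intro mult_left_mono) (auto simp: N_def)
      also have "cmod t * N < r" using t r by (simp add: field_simps)
      finally have "E_norm \<rho> p n (\<lambda>z. (f z - g0 z) + t * g z) < e" by (simp add: r_def)
      moreover have "(\<lambda>z. (f z - g0 z) + t * g z) = (\<lambda>z. (f z + t * g z) - g0 z)" by auto
      ultimately show ?thesis using E_space_add_cmult[OF \<rho> fE g] by (simp add: s(1))
    qed
    then show ?case using r by (intro exI[of _ "r / N"]) auto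
  qed auto
qed

lemma diff_monomial_cmult:
  assumes "f holomorphic_on UNIV"
  shows "diff_monomial M (\<lambda>z. c * f z) z = c ^ size M * diff_monomial M f z"
  unfolding diff_monomial_def
  by (induction M) (auto simp: higher_deriv_cmult[OF assms, of z])

lemma lin_dep_cmult:
  assumes f: "f holomorphic_on UNIV" and c: "c \<noteq> 0"
    and dep: "lin_dep (map (\<lambda>M. diff_monomial M (\<lambda>z. c * f z)) Ms)"
  shows "lin_dep (map (\<lambda>M. diff_monomial M f) Ms)"
proof -
  obtain a where a: "\<exists>i<length Ms. a i \<noteq> 0"
    "\<And>z. (\<Sum>i<length Ms. a i * diff_monomial (Ms ! i) (\<lambda>z. c * f z) z) = 0"
    using dep unfolding lin_dep_def by auto
  have "(\<Sum>i<length Ms. (a i * c ^ size (Ms ! i)) * diff_monomial (Ms ! i) f z) = 0" for z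
    using a(2)[of z] by (simp add: diff_monomial_cmult[OF f] mult.assoc)
  then show ?thesis
    unfolding lin_dep_def using a(1) c by (intro exI[of _ "\<lambda>i. a i * c ^ size (Ms ! i)"]) auto
qed

text \<open>With s = 1/t, f + t g = t (g + s f), and the factor t only rescales each monomial. The
  determinant \<open>H\<close> is entire in s and nonzero at s = 0, where the function is
  \<open>g\<close> itself, so its zeros are countable.\<close>

lemma countable_lin_dep_line:
  assumes f: "f holomorphic_on UNIV" and g: "g holomorphic_on UNIV"
    and indep: "\<not> lin_dep (map (\<lambda>M. diff_monomial M g) Ms)"
  shows "countable {t. t \<noteq> 0 \<and> lin_dep (map (\<lambda>M. diff_monomial M (\<lambda>z. f z + t * g z)) Ms)}"
proof -
  obtain zs where zs: "elim_det (map (\<lambda>M. diff_monomial M g) Ms) zs \<noteq> 0"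
    using not_lin_dep_imp_elim_det[OF indep] by blast
  define H where "H s = elim_det (map (\<lambda>M. diff_monomial M (\<lambda>z. g z + s * f z)) Ms) zs" for s
  have hd: "(deriv ^^ j) (\<lambda>z. g z + s * f z) z = (deriv ^^ j) g z + s * (deriv ^^ j) f z" for j s z
  proof -
    have "(deriv ^^ j) (\<lambda>z. g z + s * f z) z = (deriv ^^ j) g z + (deriv ^^ j) (\<lambda>z. s * f z) z"
      by (rule higher_deriv_add[of _ UNIV]) (use f g in \<open>auto intro: holomorphic_intros\<close>)
    then show ?thesis by (simp add: higher_deriv_cmult[OF f])
  qed
  have "(\<lambda>s. diff_monomial M (\<lambda>z. g z + s * f z) x) holomorphic_on UNIV" for M x
    unfolding diff_monomial_def hd by (induction M) (auto intro!: holomorphic_intros)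
  then have "H holomorphic_on UNIV"
    using elim_det_holomorphic[of "map (\<lambda>M s. diff_monomial M (\<lambda>z. g z + s * f z)) Ms" UNIV zs]
    unfolding H_def by (auto simp: o_def)
  have "countable {s. H s = 0}"
  proof (rule ccontr)
    assume "uncountable {s. H s = 0}"
    from holomorphic_countable_equal_UNIV[OF \<open>H holomorphic_on UNIV\<close> holomorphic_on_const this]
    have "H 0 = 0" by simp
    then show False using zs by (simp add: H_def)
  qed
  then have "countable (inverse ` {s. H s = 0})" by (rule countable_image)
  moreover have "{t. t \<noteq> 0 \<and> lin_dep (map (\<lambda>M. diff_monomial M (\<lambda>z. f z + t * g z)) Ms)} \<subseteq> inverse ` {s. H s = 0}"
  proof safe
    fix t :: complex assume t: "t \<noteq> 0" and dep: "lin_dep (map (\<lambda>M. diff_monomial M (\<lambda>z. f z + t * g z)) Ms)"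
    have eq: "(\<lambda>z. f z + t * g z) = (\<lambda>z. t * (g z + inverse t * f z))" using t by (auto simp: field_simps)
    have "(\<lambda>z. g z + inverse t * f z) holomorphic_on UNIV" using f g by (intro holomorphic_intros)
    then have "lin_dep (map (\<lambda>M. diff_monomial M (\<lambda>z. g z + inverse t * f z)) Ms)"
      using t dep unfolding eq by (rule lin_dep_cmult)
    then have "H (inverse t) = 0" unfolding H_def by (rule lin_dep_imp_elim_det)
    then show "t \<in> inverse ` {s. H s = 0}" by (intro image_eqI[of _ _ "inverse t"]) auto
  qed
  ultimately show ?thesis by (rule countable_subset[rotated])
qed

lemma closure_of_diff_transcendental:
  assumes \<rho>: "\<rho> \<ge> 1" and g: "g \<in> E_space \<rho> p" "\<not> diff_algebraic g"
  shows "(E_topology \<rho> p) closure_of {f \<in> E_space \<rho> p. \<not> diff_algebraic f} = E_space \<rho> p"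
proof -
  have "f \<in> (E_topology \<rho> p) closure_of {f \<in> E_space \<rho> p. \<not> diff_algebraic f}" if f: "f \<in> E_space \<rho> p" for f
    unfolding in_closure_of
  proof (intro conjI allI impI)
    show "f \<in> topspace (E_topology \<rho> p)" using f by (simp add: topspace_E_topology)
    fix T assume T: "f \<in> T \<and> openin (E_topology \<rho> p) T"
    obtain d where d: "d > 0" "\<And>t. cmod t < d \<Longrightarrow> (\<lambda>z. f z + t * g z) \<in> T"
      using eventually_line_in_open[OF \<rho> _ _ g(1)] T by blast
    \<comment> \<open>The exceptional parameters of all families together; 0 is added because only
      nonzero t are controlled by \<open>countable_lin_dep_line\<close>.\<close>
    define X where "X = insert 0 (\<Union>Ms\<in>{Ms. distinct Ms}.
      {t. t \<noteq> 0 \<and> lin_dep (map (\<lambda>M. diff_monomial M (\<lambda>z. f z + t * g z)) Ms)})"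
    have "countable {Ms :: nat multiset list. distinct Ms}"
      using countable_multiset_lists by (rule countable_subset[rotated]) simp
    moreover have "\<not> lin_dep (map (\<lambda>M. diff_monomial M g) Ms)" if "distinct Ms" for Ms
      using g(2) that by (auto simp: diff_algebraic_def)
    ultimately have "countable X"
      unfolding X_def using countable_lin_dep_line[OF E_space_holomorphic[OF f] E_space_holomorphic[OF g(1)]]
      by (intro countable_insert countable_UN) auto
    then have "\<not> ball 0 d \<subseteq> X" using uncountable_ball[OF d(1)] countable_subset by blast
    then obtain t where "t \<in> ball 0 d" "t \<notin> X" by blast
    then have t: "cmod t < d" "t \<notin> X" by simp_all
    have "\<not> diff_algebraic (\<lambda>z. f z + t * g z)"
      using t(2) unfolding X_def diff_algebraic_def by auto
    then show "\<exists>y. y \<in> {f \<in> E_space \<rho> p. \<not> diff_algebraic f} \<and> y \<in> T"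
      using d(2)[OF t(1)] E_space_add_cmult[OF \<rho> f g(1)] by blast
  qed
  moreover have "(E_topology \<rho> p) closure_of {f \<in> E_space \<rho> p. \<not> diff_algebraic f} \<subseteq> E_space \<rho> p"
    using closure_of_subset_topspace[of "E_topology \<rho> p"] by (simp only: topspace_E_topology)
  ultimately show ?thesis by blast
qed

section \<open>A lacunary series\<close>

text \<open>Divisibility by X^N, stated as a predicate so that the zero series satisfies it for
  every \<open>N\<close>.\<close>

definition vanish_below :: "nat \<Rightarrow> complex fps \<Rightarrow> bool" where
  "vanish_below N F \<longleftrightarrow> (\<forall>i<N. fps_nth F i = 0)"

definition vanish_above :: "nat \<Rightarrow> complex fps \<Rightarrow> bool" where
  "vanish_above N F \<longleftrightarrow> (\<forall>i>N. fps_nth F i = 0)"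

lemma vanish_below_mono: "vanish_below N F \<Longrightarrow> K \<le> N \<Longrightarrow> vanish_below K F"
  by (auto simp: vanish_below_def)

lemma vanish_below_add: "vanish_below N F \<Longrightarrow> vanish_below N G \<Longrightarrow> vanish_below N (F + G)"
  by (auto simp: vanish_below_def)

lemma vanish_below_minus: "vanish_below N F \<Longrightarrow> vanish_below N (- F)"
  by (auto simp: vanish_below_def)

lemma vanish_below_sum: "(\<And>i. i \<in> I \<Longrightarrow> vanish_below N (F i)) \<Longrightarrow> vanish_below N (\<Sum>i\<in>I. F i)"
  by (auto simp: vanish_below_def fps_sum_nth intro!: sum.neutral)

lemma vanish_below_mult:
  assumes "vanish_below N F" "vanish_below K G"
  shows "vanish_below (N + K) (F * G)"
  unfolding vanish_below_def
proof (intro allI impI)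
  fix i assume i: "i < N + K"
  have "fps_nth F j * fps_nth G (i - j) = 0" if "j \<le> i" for j
    using assms that i by (cases "j < N") (auto simp: vanish_below_def)
  then show "fps_nth (F * G) i = 0" unfolding fps_mult_nth by (intro sum.neutral) auto
qed

lemma vanish_below_mult_left: "vanish_below N G \<Longrightarrow> vanish_below N (F * G)"
  using vanish_below_mult[of 0 F N G] by (simp add: vanish_below_def)

lemma vanish_below_mult_right: "vanish_below N F \<Longrightarrow> vanish_below N (F * G)"
  using vanish_below_mult[of N F 0 G] by (simp add: vanish_below_def)

lemma vanish_below_deriv: "vanish_below N F \<Longrightarrow> vanish_below (N - j) ((fps_deriv ^^ j) F)"
proof (induction j)
  case (Suc j)
  then have "vanish_below (N - j) ((fps_deriv ^^ j) F)" .
  then show ?case by (auto simp: vanish_below_def)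
qed simp

lemma vanish_above_sum: "(\<And>i. i \<in> I \<Longrightarrow> vanish_above N (F i)) \<Longrightarrow> vanish_above N (\<Sum>i\<in>I. F i)"
  by (auto simp: vanish_above_def fps_sum_nth intro!: sum.neutral)

lemma vanish_above_mult:
  assumes "vanish_above N F" "vanish_above K G"
  shows "vanish_above (N + K) (F * G)"
  unfolding vanish_above_def
proof (intro allI impI)
  fix i assume i: "i > N + K"
  have "fps_nth F j * fps_nth G (i - j) = 0" for j
    using assms i by (cases "j > N") (auto simp: vanish_above_def)
  then show "fps_nth (F * G) i = 0" unfolding fps_mult_nth by (intro sum.neutral) auto
qed

lemma vanish_above_mono: "vanish_above N F \<Longrightarrow> N \<le> K \<Longrightarrow> vanish_above K F"
  by (auto simp: vanish_above_def)

lemma vanish_above_deriv: "vanish_above N F \<Longrightarrow> vanish_above N ((fps_deriv ^^ j) F)"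
  by (induction j) (auto simp: vanish_above_def)

definition fps_monomial :: "nat multiset \<Rightarrow> (nat \<Rightarrow> complex fps) \<Rightarrow> complex fps" where
  "fps_monomial M x = (\<Prod>j\<in>#M. x j)"

lemma vanish_above_monomial:
  "(\<And>j. vanish_above K (x j)) \<Longrightarrow> vanish_above (size M * K) (fps_monomial M x)"
proof (induction M)
  case empty
  then show ?case by (simp add: fps_monomial_def vanish_above_def)
next
  case (add a M)
  then show ?case using vanish_above_mult[of K "x a" "size M * K"] by (simp add: fps_monomial_def)
qed

section \<open>Linearization of differential polynomials\<close>

text \<open>\<open>of_nat (count M j) * fps_monomial (M - {#j#}) x\<close> is the partial derivative
  of the monomial in its variable \<open>x j\<close>; the remainder is quadratic in
  \<open>h\<close>.\<close>

lemma fps_monomial_taylor: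
  assumes "\<And>j. j \<le> n \<Longrightarrow> vanish_below N (h j)" "set_mset M \<subseteq> {..n}"
  shows "vanish_below (2 * N) (fps_monomial M (\<lambda>j. x j + h j) - fps_monomial M x -
    (\<Sum>j\<le>n. of_nat (count M j) * h j * fps_monomial (M - {#j#}) x))"
  using assms(2)
proof (induction M)
  case empty
  then show ?case by (simp add: fps_monomial_def vanish_below_def)
next
  case (add a M)
  define A where "A = fps_monomial M (\<lambda>j. x j + h j)"
  define B where "B = fps_monomial M x"
  define L where "L = (\<Sum>j\<le>n. of_nat (count M j) * h j * fps_monomial (M - {#j#}) x)"
  have IH: "vanish_below (2 * N) (A - B - L)" using add by (simp add: A_def B_def L_def)
  have a: "a \<le> n" using add.prems by simp
  have L: "vanish_below N L"
    unfolding L_def by (intro vanish_below_sum vanish_below_mult_right vanish_below_mult_left assms) auto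
  have "of_nat (count (add_mset a M) j) * h j * fps_monomial (add_mset a M - {#j#}) x =
      x a * (of_nat (count M j) * h j * fps_monomial (M - {#j#}) x) + (if j = a then h a * B else 0)" for j
  proof -
    have *: "of_nat (count M j) * fps_monomial (add_mset a M - {#j#}) x =
        of_nat (count M j) * (x a * fps_monomial (M - {#j#}) x)"
    proof (cases "j \<in># M")
      case True
      then have "add_mset a M - {#j#} = add_mset a (M - {#j#})" by simp
      then show ?thesis by (simp add: fps_monomial_def)
    qed (simp add: not_in_iff)
    show ?thesis
    proof (cases "j = a")
      case True
      then show ?thesis using * by (simp add: B_def algebra_simps)
    next
      case False
      have "of_nat (count (add_mset a M) j) * h j * fps_monomial (add_mset a M - {#j#}) x =
        h j * (of_nat (count M j) * fps_monomial (add_mset a M - {#j#}) x)"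
        using False by simp
      then show ?thesis using False unfolding * by (simp add: algebra_simps)
    qed
  qed
  then have "(\<Sum>j\<le>n. of_nat (count (add_mset a M) j) * h j * fps_monomial (add_mset a M - {#j#}) x) =
      x a * L + h a * B"
    using a by (simp add: sum.distrib sum_distrib_left L_def)
  moreover have "fps_monomial (add_mset a M) (\<lambda>j. x j + h j) = (x a + h a) * A"
    "fps_monomial (add_mset a M) x = x a * B"
    by (simp_all add: fps_monomial_def A_def B_def)
  ultimately have eq: "fps_monomial (add_mset a M) (\<lambda>j. x j + h j) - fps_monomial (add_mset a M) x -
     (\<Sum>j\<le>n. of_nat (count (add_mset a M) j) * h j * fps_monomial (add_mset a M - {#j#}) x) =
     x a * (A - B - L) + h a * ((A - B - L) + L)"
    by (simp add: algebra_simps)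
  \<comment> \<open>This is A - B, the full increment, of order \<open>N\<close>; multiplied by
    \<open>h a\<close> it reaches order 2N.\<close>
  have "vanish_below N ((A - B - L) + L)"
    by (intro vanish_below_add L vanish_below_mono[OF IH]) simp
  from vanish_below_mult[OF assms(1)[OF a] this]
  have "vanish_below (2 * N) (h a * ((A - B - L) + L))" by (simp add: mult_2)
  then show ?case unfolding eq by (rule vanish_below_add[OF vanish_below_mult_left[OF IH]])
qed

definition fps_poly :: "nat multiset set \<Rightarrow> (nat multiset \<Rightarrow> complex) \<Rightarrow> (nat \<Rightarrow> complex fps) \<Rightarrow> complex fps" where
  "fps_poly S c x = (\<Sum>M\<in>S. fps_const (c M) * fps_monomial M x)"

lemma fps_poly_taylor:
  assumes h: "\<And>j. j \<le> n \<Longrightarrow> vanish_below N (h j)" and S: "\<And>M. M \<in> S \<Longrightarrow> set_mset M \<subseteq> {..n}"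
  shows "vanish_below (2 * N) (fps_poly S c (\<lambda>j. x j + h j) - fps_poly S c x -
    (\<Sum>j\<le>n. (\<Sum>M\<in>S. fps_const (c M) * (of_nat (count M j) * fps_monomial (M - {#j#}) x)) * h j))"
proof -
  have "vanish_below (2 * N) (\<Sum>M\<in>S. fps_const (c M) * (fps_monomial M (\<lambda>j. x j + h j) - fps_monomial M x -
    (\<Sum>j\<le>n. of_nat (count M j) * h j * fps_monomial (M - {#j#}) x)))"
    by (intro vanish_below_sum vanish_below_mult_left fps_monomial_taylor[OF h S])
  moreover have "(\<Sum>j\<le>n. (\<Sum>M\<in>S. fps_const (c M) * (of_nat (count M j) * fps_monomial (M - {#j#}) x)) * h j) =
    (\<Sum>M\<in>S. fps_const (c M) * (\<Sum>j\<le>n. of_nat (count M j) * h j * fps_monomial (M - {#j#}) x))"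
    unfolding sum_distrib_left sum_distrib_right
    by (subst sum.swap) (simp add: mult_ac)
  ultimately show ?thesis
    by (simp add: fps_poly_def right_diff_distrib sum_subtractf)
qed

section \<open>Linear differential operators on power series\<close>

lemma fps_deriv_power_nth:
  "fps_nth ((fps_deriv ^^ j) F) i = (\<Prod>l<j. of_nat (i + j - l)) * fps_nth F (i + j)" for F :: "complex fps"
proof (induction j arbitrary: i)
  case (Suc j)
  have "fps_nth ((fps_deriv ^^ Suc j) F) i = of_nat (Suc i) * fps_nth ((fps_deriv ^^ j) F) (Suc i)"
    by simp
  also have "\<dots> = of_nat (Suc i) * ((\<Prod>l<j. of_nat (Suc i + j - l)) * fps_nth F (Suc i + j))"
    by (simp only: Suc.IH)
  also have "\<dots> = (\<Prod>l<Suc j. of_nat (i + Suc j - l)) * fps_nth F (i + Suc j)"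
    by simp
  finally show ?case .
qed simp

lemma falling_factorials_independent:
  assumes inf: "infinite X" and zero: "\<And>m. m \<in> X \<Longrightarrow> (\<Sum>j\<le>n. \<beta> j * (\<Prod>l<j. of_nat m - of_nat l)) = (0 :: complex)"
    and j: "j \<le> n"
  shows "\<beta> j = 0"
proof (rule ccontr)
  assume "\<beta> j \<noteq> 0"
  \<comment> \<open>At the point \<open>k\<close>, the least index with a nonzero coefficient, all
    later falling factorials contain the factor k - k. Only one term survives, so the polynomial
    \<open>q\<close> is nonzero and has finitely many roots.\<close>
  define k where "k = (LEAST j. \<beta> j \<noteq> 0)"
  have k1: "\<beta> k \<noteq> 0" unfolding k_def by (rule LeastI[of _ j]) (fact \<open>\<beta> j \<noteq> 0\<close>)
  have k2: "\<beta> i = 0" if "i < k" for i using not_less_Least[OF that[unfolded k_def]] by simp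
  have k3: "k \<le> n" using Least_le[of "\<lambda>j. \<beta> j \<noteq> 0" j] \<open>\<beta> j \<noteq> 0\<close> j by (simp add: k_def)
  note k = k1 k2 k3
  define q where "q = (\<Sum>j\<le>n. smult (\<beta> j) (\<Prod>l<j. [:- of_nat l, 1:]))"
  have q: "poly q x = (\<Sum>j\<le>n. \<beta> j * (\<Prod>l<j. x - of_nat l))" for x
    by (simp add: q_def poly_sum poly_prod)
  have "(\<Sum>j\<le>n. \<beta> j * (\<Prod>l<j. of_nat k - of_nat l)) = (\<Sum>j\<le>n. if j = k then \<beta> k * (\<Prod>l<k. of_nat k - of_nat l) else 0)"
  proof (intro sum.cong refl)
    fix j assume "j \<in> {..n}"
    show "\<beta> j * (\<Prod>l<j. of_nat k - of_nat l) = (if j = k then \<beta> k * (\<Prod>l<k. of_nat k - of_nat l) else 0)"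
    proof (cases j k rule: linorder_cases)
      case greater
      then have "(\<Prod>l<j. of_nat k - of_nat l) = (0::complex)" by (intro prod_zero) auto
      then show ?thesis using greater by simp
    qed (use k(2) in auto)
  qed
  then have "poly q (of_nat k) = \<beta> k * (\<Prod>l<k. of_nat k - of_nat l)" using k(3) by (simp add: q)
  moreover have "(\<Prod>l<k. of_nat k - of_nat l) \<noteq> (0::complex)" by (auto simp: prod_zero_iff)
  ultimately have "q \<noteq> 0" using k(1) by auto
  then have "finite {x. poly q x = 0}" by (rule poly_roots_finite)
  moreover have "of_nat ` X \<subseteq> {x. poly q x = 0}" using zero by (auto simp: q)
  moreover have "infinite (of_nat ` X :: complex set)" using inf by (simp add: finite_image_iff inj_on_def)
  ultimately show False using finite_subset by blast
qed

text \<open>A linear differential operator sends the lowest term \<open>z\<^sup>m\<close> of a series to a multiple of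
  \<open>z\<^sup>m\<^sup>+\<^sup>e\<^sup>-\<^sup>n\<close> by a nonzero polynomial in \<open>m\<close>.\<close>

lemma linear_operator_zero:
  fixes b :: "nat \<Rightarrow> complex fps" and r :: "nat \<Rightarrow> complex fps"
  assumes inf: "infinite X"
    and r: "\<And>m. m \<in> X \<Longrightarrow> vanish_below m (r m)" "\<And>m. m \<in> X \<Longrightarrow> fps_nth (r m) m \<noteq> 0"
    and small: "\<And>m. m \<in> X \<Longrightarrow> vanish_below (2 * (m - n)) (\<Sum>j\<le>n. b j * (fps_deriv ^^ j) (r m))"
    and j: "j \<le> n"
  shows "b j = 0"
proof (rule ccontr)
  assume nz: "b j \<noteq> 0"
  \<comment> \<open>Multiplying the operator by X^n turns it into a sum of B_j X^j D^j, D being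
    differentiation, and X^j D^j multiplies the coefficient of X^i by a falling factorial in i
    without moving it.\<close>
  define B where "B j = fps_X ^ (n - j) * b j" for j
  have "B j \<noteq> 0" using nz by (simp add: B_def)
  then have ex: "\<exists>i. \<exists>j\<le>n. fps_nth (B j) i \<noteq> 0" using j by (auto simp: fps_eq_iff)
  \<comment> \<open>The lowest exponent in any \<open>B j\<close>; the coefficient of X^(m+e) then
    sees only these terms and the lowest term of \<open>r m\<close>.\<close>
  define e where "e = (LEAST i. \<exists>j\<le>n. fps_nth (B j) i \<noteq> 0)"
  obtain k where k: "k \<le> n" "fps_nth (B k) e \<noteq> 0"
    using LeastI_ex[OF ex] unfolding e_def by blast
  have min: "fps_nth (B j) i = 0" if "i < e" "j \<le> n" for i j
    using not_less_Least[of i "\<lambda>i. \<exists>j\<le>n. fps_nth (B j) i \<noteq> 0"] that by (auto simp: e_def)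
  define \<theta> where "\<theta> m j = fps_X ^ j * (fps_deriv ^^ j) (r m)" for m j
  have \<theta>: "fps_nth (\<theta> m j) i = (\<Prod>l<j. of_nat i - of_nat l) * fps_nth (r m) i" for m j i
  proof (cases "i < j")
    case True
    then have "(\<Prod>l<j. of_nat i - of_nat l) = (0::complex)" by (intro prod_zero) auto
    then show ?thesis using True by (simp add: \<theta>_def fps_X_power_mult_nth)
  next
    case False
    have "(\<Prod>l<j. of_nat (i - j + j - l)) = (\<Prod>l<j. of_nat i - of_nat l :: complex)"
      using False by (intro prod.cong) (auto simp: of_nat_diff)
    then show ?thesis using False by (simp add: \<theta>_def fps_X_power_mult_nth fps_deriv_power_nth)
  qed
  \<comment> \<open>m > n + e means m + e - n < 2 (m - n), so the smallness hypothesis covers the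
    coefficient of X^(m+e) after multiplication by X^n.\<close>
  define Y where "Y = {m \<in> X. n + e < m}"
  have "X \<subseteq> Y \<union> {..n + e}" by (auto simp: Y_def)
  then have "infinite Y" using inf by (meson finite_Un finite_atMost finite_subset)
  moreover have "(\<Sum>j\<le>n. fps_nth (B j) e * (\<Prod>l<j. of_nat m - of_nat l)) = 0" if m: "m \<in> Y" for m
  proof -
    have mX: "m \<in> X" "n + e < m" using m by (auto simp: Y_def)
    have "fps_nth (B j * \<theta> m j) (m + e) = fps_nth (B j) e * fps_nth (\<theta> m j) m" if "j \<le> n" for j
    proof -
      have "fps_nth (B j) i * fps_nth (\<theta> m j) (m + e - i) =
          (if i = e then fps_nth (B j) e * fps_nth (\<theta> m j) m else 0)" if "i \<le> m + e" for i
        using min[of i j] \<open>j \<le> n\<close> r(1)[OF mX(1)] that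
        by (cases i e rule: linorder_cases) (auto simp: \<theta> vanish_below_def)
      then have "fps_nth (B j * \<theta> m j) (m + e) =
          (\<Sum>i=0..m + e. if i = e then fps_nth (B j) e * fps_nth (\<theta> m j) m else 0)"
        unfolding fps_mult_nth by (intro sum.cong) auto
      then show ?thesis by simp
    qed
    then have "fps_nth (\<Sum>j\<le>n. B j * \<theta> m j) (m + e) = (\<Sum>j\<le>n. fps_nth (B j) e * fps_nth (\<theta> m j) m)"
      by (simp add: fps_sum_nth)
    also have "\<dots> = (\<Sum>j\<le>n. fps_nth (B j) e * (\<Prod>l<j. of_nat m - of_nat l)) * fps_nth (r m) m"
      by (simp add: \<theta> sum_distrib_right mult.assoc)
    finally have coeff: "fps_nth (\<Sum>j\<le>n. B j * \<theta> m j) (m + e) = \<dots>" .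
    have "(\<Sum>j\<le>n. B j * \<theta> m j) = fps_X ^ n * (\<Sum>j\<le>n. b j * (fps_deriv ^^ j) (r m))"
      unfolding sum_distrib_left
    proof (intro sum.cong refl)
      fix j assume "j \<in> {..n}"
      then have "fps_X ^ n = (fps_X ^ (n - j) * fps_X ^ j :: complex fps)" by (simp flip: power_add)
      then show "B j * \<theta> m j = fps_X ^ n * (b j * (fps_deriv ^^ j) (r m))"
        by (simp add: B_def \<theta>_def mult_ac)
    qed
    then have "fps_nth (\<Sum>j\<le>n. B j * \<theta> m j) (m + e) = 0"
      using small[OF mX(1)] mX(2) by (simp add: fps_X_power_mult_nth vanish_below_def)
    then show ?thesis using coeff r(2)[OF mX(1)] by simp
  qed
  ultimately have "fps_nth (B k) e = 0"
    using k(1) by (rule falling_factorials_independent)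
  then show False using k(2) by contradiction
qed

text \<open>Let P be the relation and s the part of \<open>G\<close> below K = m (Suc k). P(s) has
  degree at most a multiple of m k, but agrees with P(G) = 0 below order K - n, so the gap forces
  P(s) = 0. Then the linear part of P at \<open>G\<close> along the tail vanishes to order 2 (K -
  n), which kills all partial derivatives of P at \<open>G\<close>. These are relations of lower
  degree, so induction applies.\<close>

lemma lacunary_independent:
  fixes G :: "complex fps" and m :: "nat \<Rightarrow> nat"
  assumes mono: "strict_mono m"
    and gap: "\<And>d n. \<exists>k0. \<forall>k\<ge>k0. d * m k + n < m (Suc k)"
    and G: "\<And>i. fps_nth G i \<noteq> 0 \<longleftrightarrow> i \<in> range m"
    and S: "finite S" "\<And>M. M \<in> S \<Longrightarrow> size M \<le> d" "fps_poly S c (\<lambda>j. (fps_deriv ^^ j) G) = 0"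
    and M: "M \<in> S"
  shows "c M = 0"
  using S M
proof (induction d arbitrary: S c M)
  case 0
  then have "S = {{#}}" "M = {#}" by auto
  then show ?case using "0.prems"(3) by (simp add: fps_poly_def fps_monomial_def)
next
  case (Suc d)
  let ?J = "\<lambda>j. (fps_deriv ^^ j) G"
  have "finite (\<Union>M\<in>S. set_mset M)" using Suc.prems(1) by auto
  then obtain n where n: "\<And>M. M \<in> S \<Longrightarrow> set_mset M \<subseteq> {..n}"
    unfolding finite_nat_set_iff_bounded_le by fastforce
  \<comment> \<open>The partial derivative of the relation with respect to its \<open>j\<close>-th
    variable, evaluated at \<open>G\<close>: a coefficient of the linearized operator.\<close>
  define b where "b j = (\<Sum>M\<in>S. fps_const (c M) * (of_nat (count M j) * fps_monomial (M - {#j#}) ?J))" for j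
  obtain k0 where k0: "\<And>k. k \<ge> k0 \<Longrightarrow> Suc d * m k + n < m (Suc k)" using gap by blast
  define r where "r K = G - fps_cutoff K G" for K
  define X where "X = (\<lambda>k. m (Suc k)) ` {k0..}"
  have "inj (\<lambda>k. m (Suc k))" using mono by (auto simp: inj_on_def strict_mono_eq)
  then have "infinite X" unfolding X_def by (simp add: finite_image_iff inj_on_subset infinite_Ici)
  moreover have "vanish_below K (r K)" for K by (simp add: r_def vanish_below_def)
  moreover have "fps_nth (r K) K \<noteq> 0" if "K \<in> X" for K using that G[of K] by (auto simp: r_def X_def)
  moreover have "vanish_below (2 * (K - n)) (\<Sum>j\<le>n. b j * (fps_deriv ^^ j) (r K))" if K: "K \<in> X" for K
  proof -
    obtain k where k: "k \<ge> k0" "K = m (Suc k)" using K by (auto simp: X_def)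
    define s where "s = fps_cutoff K G"
    define h where "h j = - (fps_deriv ^^ j) (r K)" for j
    have s: "(fps_deriv ^^ j) s = ?J j + h j" for j
    proof -
      have "(fps_deriv ^^ j) (G - r K) = ?J j - (fps_deriv ^^ j) (r K)"
        by (induction j) auto
      then show ?thesis by (simp add: s_def r_def h_def)
    qed
    have h: "vanish_below (K - n) (h j)" if "j \<le> n" for j
      unfolding h_def using \<open>\<And>K. vanish_below K (r K)\<close>[of K] that
      by (intro vanish_below_minus vanish_below_mono[OF vanish_below_deriv]) auto
    have "vanish_above (m k) s"
      unfolding vanish_above_def
    proof (intro allI impI)
      fix i assume i: "i > m k"
      have "i < K \<Longrightarrow> i \<notin> range m"
        using i mono k(2) by (auto simp: strict_mono_less less_Suc_eq_le)
      then show "fps_nth s i = 0" using G[of i] by (auto simp: s_def)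
    qed
    then have "vanish_above (m k) ((fps_deriv ^^ j) s)" for j by (rule vanish_above_deriv)
    then have mon: "vanish_above (size M * m k) (fps_monomial M (\<lambda>j. (fps_deriv ^^ j) s))" for M
      by (rule vanish_above_monomial)
    have "vanish_above (Suc d * m k) (fps_poly S c (\<lambda>j. (fps_deriv ^^ j) s))"
      unfolding fps_poly_def
    proof (rule vanish_above_sum)
      fix M assume "M \<in> S"
      then have "size M * m k \<le> Suc d * m k" using Suc.prems(2) by (intro mult_le_mono1)
      then show "vanish_above (Suc d * m k) (fps_const (c M) * fps_monomial M (\<lambda>j. (fps_deriv ^^ j) s))"
        using vanish_above_mono[OF mon[of M]] by (simp add: vanish_above_def)
    qed
    moreover define L where "L = (\<Sum>j\<le>n. b j * h j)"
    have tay: "vanish_below (2 * (K - n)) (fps_poly S c (\<lambda>j. (fps_deriv ^^ j) s) - L)"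
      using fps_poly_taylor[where n = n and N = "K - n" and h = h and S = S and c = c and x = ?J, OF h n] Suc.prems(3) by (simp add: s L_def b_def)
    have L: "vanish_below (K - n) L"
      unfolding L_def by (intro vanish_below_sum vanish_below_mult_left h) auto
    have "vanish_below (K - n) ((fps_poly S c (\<lambda>j. (fps_deriv ^^ j) s) - L) + L)"
      by (intro vanish_below_add L vanish_below_mono[OF tay]) simp
    moreover have "Suc d * m k < K - n" using k0[OF k(1)] k(2) by simp
    ultimately have "fps_nth (fps_poly S c (\<lambda>j. (fps_deriv ^^ j) s)) i = 0" for i
      by (cases "i < K - n") (auto simp: vanish_below_def vanish_above_def)
    then have "fps_poly S c (\<lambda>j. (fps_deriv ^^ j) s) = 0" by (simp add: fps_eq_iff)
    then have "vanish_below (2 * (K - n)) (- L)" using tay by simp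
    then show ?thesis by (simp add: L_def h_def sum_negf)
  qed
  ultimately have b0: "b j = 0" if "j \<le> n" for j
    using that by (rule linear_operator_zero)
  have nonempty: "c M = 0" if M: "M \<in> S" "j \<in># M" for M j
  proof -
    \<comment> \<open>\<open>b j = 0\<close> as a relation indexed by what is left after removing
      one \<open>j\<close>. The removal is injective on monomials containing \<open>j\<close>, so no
      coefficients merge, and the factor from differentiation is nonzero.\<close>
    define S' where "S' = {M. add_mset j M \<in> S}"
    define c' where "c' M = c (add_mset j M) * of_nat (Suc (count M j))" for M
    have "S' = (\<lambda>M. M - {#j#}) ` {M \<in> S. j \<in># M}"
      by (force simp: S'_def image_iff)
    then have "finite S'" using Suc.prems(1) by simp
    moreover have "size M \<le> d" if "M \<in> S'" for M using Suc.prems(2)[of "add_mset j M"] that by (simp add: S'_def)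
    moreover have "fps_poly S' c' ?J = b j"
    proof -
      have "b j = (\<Sum>M\<in>{M \<in> S. j \<in># M}. fps_const (c M) * (of_nat (count M j) * fps_monomial (M - {#j#}) ?J))"
        unfolding b_def using Suc.prems(1) by (intro sum.mono_neutral_right) (auto simp: not_in_iff)
      also have "\<dots> = fps_poly S' c' ?J"
        unfolding fps_poly_def
        by (rule sum.reindex_bij_witness[of _ "add_mset j" "\<lambda>M. M - {#j#}"])
          (auto simp: S'_def c'_def fps_of_nat[symmetric] mult.assoc[symmetric] simp del: of_nat_Suc)
      finally show ?thesis ..
    qed
    moreover have "j \<le> n" using n[OF M(1)] M(2) by auto
    moreover have "M - {#j#} \<in> S'" using M by (simp add: S'_def)
    ultimately have "c' (M - {#j#}) = 0" using Suc.IH[of S' c' "M - {#j#}"] b0 by simp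
    then show ?thesis using M(2) by (auto simp: c'_def count_eq_zero_iff simp del: of_nat_Suc)
  qed
  show ?case
  proof (cases "M = {#}")
    case True
    \<comment> \<open>Only the constant monomial is left, so the relation itself says that its
      coefficient is zero.\<close>
    have "fps_poly S c ?J = (\<Sum>M'\<in>S. if M' = {#} then fps_const (c {#}) else 0)"
      unfolding fps_poly_def using nonempty
      by (intro sum.cong) (auto simp: fps_monomial_def dest: multiset_nonemptyE)
    then show ?thesis using Suc.prems(1,3,4) True by simp
  next
    case False
    then show ?thesis using nonempty[OF Suc.prems(4)] by (auto elim: multiset_nonemptyE)
  qed
qed

section \<open>The series with factorial exponents\<close>

text \<open>The ratio k + 2 of successive exponents is unbounded. Starting with \<open>Suc k\<close>
  avoids the coincidence 0! = 1!, which would spoil strict monotonicity.\<close>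

definition lacunary_fps :: "complex fps" where
  "lacunary_fps = Abs_fps (\<lambda>i. if \<exists>k. i = fact (Suc k) then 1 / (fact i)\<^sup>2 else 0)"

text \<open>The two factorials are shared out: (1/q)^i / i! is one term of the series of exp(1/q),
  and (q |z|)^i / i! is left for exp(q |z|). Both convergence and growth follow.\<close>

lemma lacunary_fps_bound:
  assumes "q > 0"
  shows "cmod (fps_nth lacunary_fps i * z ^ i) \<le> exp (1 / q) * ((q * cmod z) ^ i /\<^sub>R fact i)"
proof -
  have "cmod (fps_nth lacunary_fps i * z ^ i) \<le> cmod z ^ i / (fact i)\<^sup>2"
    by (auto simp: lacunary_fps_def norm_mult norm_divide norm_power)
  also have "\<dots> = ((1 / q) ^ i /\<^sub>R fact i) * ((q * cmod z) ^ i /\<^sub>R fact i)"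
    using assms by (simp add: field_simps power2_eq_square)
  also have "(1 / q) ^ i /\<^sub>R fact i \<le> exp (1 / q)"
  proof -
    have s: "(\<lambda>n. (1 / q) ^ n /\<^sub>R fact n) sums exp (1 / q)" by (rule exp_converges)
    have "(\<Sum>n\<in>{i}. (1 / q) ^ n /\<^sub>R fact n) \<le> (\<Sum>n. (1 / q) ^ n /\<^sub>R fact n)"
      using assms s by (intro sum_le_suminf) (auto simp: sums_iff)
    then show ?thesis using s by (simp add: sums_iff)
  qed
  finally show ?thesis using assms by (simp add: mult_right_mono)
qed

lemma lacunary_fps_conv_radius: "fps_conv_radius lacunary_fps = \<infinity>"
  unfolding fps_conv_radius_def
proof (rule conv_radius_inftyI'')
  fix z :: complex
  have "summable (\<lambda>i. exp (1 / 1) * ((1 * cmod z) ^ i /\<^sub>R fact i))"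
    by (intro summable_mult summable_exp_generic)
  then show "summable (\<lambda>n. fps_nth lacunary_fps n * z ^ n)"
    by (rule summable_comparison_test') (rule lacunary_fps_bound, simp)
qed

lemma lacunary_growth:
  assumes "q > 0"
  shows "cmod (eval_fps lacunary_fps z) \<le> exp (1 / q) * exp (q * cmod z)"
proof -
  have s: "(\<lambda>i. exp (1 / q) * ((q * cmod z) ^ i /\<^sub>R fact i)) sums (exp (1 / q) * exp (q * cmod z))"
    by (intro sums_mult exp_converges)
  have "cmod (eval_fps lacunary_fps z) \<le> (\<Sum>i. exp (1 / q) * ((q * cmod z) ^ i /\<^sub>R fact i))"
    unfolding eval_fps_def
    by (rule norm_suminf_le[OF lacunary_fps_bound[OF assms] sums_summable[OF s]])
  also have "\<dots> = exp (1 / q) * exp (q * cmod z)" by (rule sums_unique[OF s, symmetric])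
  finally show ?thesis .
qed

lemma lacunary_not_diff_algebraic: "\<not> diff_algebraic (eval_fps lacunary_fps)"
proof
  let ?g = "eval_fps lacunary_fps" and ?J = "\<lambda>j. (fps_deriv ^^ j) lacunary_fps"
  assume "diff_algebraic ?g"
  then obtain Ms c where Ms: "distinct Ms" "\<exists>i<length Ms. c i \<noteq> 0"
    "\<And>z. (\<Sum>i<length Ms. c i * diff_monomial (Ms ! i) ?g z) = 0"
    unfolding diff_algebraic_def lin_dep_def by auto
  \<comment> \<open>Moves the coefficients from list positions to monomials, as
    \<open>fps_poly\<close> expects; distinctness makes the position unique.\<close>
  define c' where "c' M = c (SOME i. i < length Ms \<and> Ms ! i = M)" for M
  have c': "c' (Ms ! i) = c i" if "i < length Ms" for i
  proof -
    have "(SOME l. l < length Ms \<and> Ms ! l = Ms ! i) = i"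
      using that Ms(1) by (intro some_equality) (auto simp: nth_eq_iff_index_eq)
    then show ?thesis by (simp add: c'_def)
  qed
  have exp: "?g has_fps_expansion lacunary_fps"
    by (rule eval_fps_has_fps_expansion) (simp add: lacunary_fps_conv_radius)
  have "(deriv ^^ j) ?g has_fps_expansion ?J j" for j
    by (induction j) (auto intro: exp has_fps_expansion_deriv)
  then have mon: "diff_monomial M ?g has_fps_expansion fps_monomial M ?J" for M
    unfolding diff_monomial_def[abs_def] fps_monomial_def
    by (induction M) (auto intro: has_fps_expansion_mult)
  have "(\<lambda>z. \<Sum>M\<in>set Ms. c' M * diff_monomial M ?g z) has_fps_expansion fps_poly (set Ms) c' ?J"
    unfolding fps_poly_def by (intro has_fps_expansion_sum has_fps_expansion_cmult_left mon)
  moreover have "(\<Sum>M\<in>set Ms. c' M * diff_monomial M ?g z) = 0" for z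
    using Ms(3)[of z] sum_nth_distinct[OF Ms(1), of "\<lambda>M. c' M * diff_monomial M ?g z"] by (simp add: c')
  ultimately have "(\<lambda>z. 0) has_fps_expansion fps_poly (set Ms) c' ?J" by simp
  then have "fps_poly (set Ms) c' ?J = 0"
    using fps_expansion_unique_complex has_fps_expansion_0 by blast
  moreover have "strict_mono (\<lambda>k. fact (Suc k) :: nat)"
    by (auto simp: strict_mono_Suc_iff)
  moreover have "\<exists>k0. \<forall>k\<ge>k0. d * fact (Suc k) + n < fact (Suc (Suc k))" for d n :: nat
  proof (intro exI[of _ "d + n"] allI impI)
    fix k assume k: "d + n \<le> k"
    have "d * fact (Suc k) + n \<le> (d + n) * fact (Suc k)"
      by (simp add: distrib_right del: fact_Suc)
    also have "\<dots> < Suc (Suc k) * fact (Suc k)"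
      using k by (intro mult_strict_right_mono) (auto simp del: fact_Suc)
    also have "\<dots> = fact (Suc (Suc k))" by simp
    finally show "d * fact (Suc k) + n < fact (Suc (Suc k))" .
  qed
  moreover have "fps_nth lacunary_fps i \<noteq> 0 \<longleftrightarrow> i \<in> range (\<lambda>k. fact (Suc k))" for i
    by (auto simp: lacunary_fps_def simp del: fact_Suc)
  moreover have "size M \<le> Max (size ` set Ms)" if "M \<in> set Ms" for M using that by simp
  ultimately have "c' M = 0" if "M \<in> set Ms" for M
    using that lacunary_independent[of "\<lambda>k. fact (Suc k)" lacunary_fps "set Ms"] by blast
  then show False using Ms(2) c' nth_mem by metis
qed

lemma lacunary_in_E_space:
  assumes \<rho>: "\<rho> \<ge> 1" and p: "p > 0"
  shows "eval_fps lacunary_fps \<in> E_space \<rho> p"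
proof (rule E_spaceI[OF _ \<rho>])
  show "eval_fps lacunary_fps holomorphic_on UNIV"
    by (rule holomorphic_on_eval_fps) (simp add: lacunary_fps_conv_radius)
  fix q assume "p < q"
  then have q: "q > 0" using p by simp
  have "cmod (eval_fps lacunary_fps z) \<le> (exp (1 / q) * exp q) * exp (q * cmod z ^ \<rho>)" for z
  proof -
    \<comment> \<open>Passes from exponent 1 to \<rho>; the summand 1 covers the unit disc and costs
      only the factor exp q.\<close>
    have "cmod z \<le> 1 + cmod z ^ \<rho>"
    proof (cases "cmod z \<le> 1")
      case True
      then show ?thesis by (simp add: add_increasing2)
    next
      case False
      then have "cmod z ^ 1 \<le> cmod z ^ \<rho>" using \<rho> by (intro power_increasing) auto
      then show ?thesis by simp
    qed
    then have "q * cmod z \<le> q * (1 + cmod z ^ \<rho>)" using q by (intro mult_left_mono) auto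
    then have "exp (q * cmod z) \<le> exp q * exp (q * cmod z ^ \<rho>)"
      by (simp add: exp_add[symmetric] distrib_left)
    then have "exp (1 / q) * exp (q * cmod z) \<le> exp (1 / q) * (exp q * exp (q * cmod z ^ \<rho>))"
      by (rule mult_left_mono) simp
    from order_trans[OF lacunary_growth[OF q] this] show ?thesis by (simp only: mult.assoc)
  qed
  then show "\<exists>C. \<forall>z. cmod (eval_fps lacunary_fps z) \<le> C * exp (q * cmod z ^ \<rho>)" by blast
qed

theorem corollary3p9:
  fixes \<rho> :: nat and p :: real
  assumes "\<rho> \<ge> 1" and "p > 0"
  shows "\<exists>A \<subseteq> E_space \<rho> p.
           gdelta_in (E_topology \<rho> p) A \<and>
           (E_topology \<rho> p) closure_of A = E_space \<rho> p \<and>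
           (\<forall>f\<in>A. inverse_not_representable f)"
proof (intro exI conjI ballI)
  let ?A = "{f \<in> E_space \<rho> p. \<not> diff_algebraic f}"
  show "?A \<subseteq> E_space \<rho> p" by blast
  show "gdelta_in (E_topology \<rho> p) ?A" by (rule gdelta_in_diff_transcendental[OF assms])
  show "(E_topology \<rho> p) closure_of ?A = E_space \<rho> p"
    by (rule closure_of_diff_transcendental[OF assms(1) lacunary_in_E_space[OF assms]
          lacunary_not_diff_algebraic])
  show "inverse_not_representable f" if "f \<in> ?A" for f
    using that by (auto intro: diff_transcendental_imp_not_representable E_space_holomorphic)
qed

end
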